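(* Let $p$ be a prime and let $1\le\alpha_1\le\alpha_2$ be integers. The number of diamonds in the subgroup lattice of the rank $2$ abelian $p$-group $\mathbb{Z}_{p^{\alpha_1}}\times\mathbb{Z}_{p^{\alpha_2}}$ is $$dm(\mathbb{Z}_{p^{\alpha_1}}\times\mathbb{Z}_{p^{\alpha_2}})=\frac{p+1}{6(p-1)}\sum_{i=1}^{\alpha_1}p^{3i-2}f_p(\alpha_1-i,\alpha_2-i),$$ where $$f_p(x_1,x_2)=(x_2-x_1+1)p^{x_1+2}-(x_2-x_1-1)p^{x_1+1}-(x_1+x_2+3)p+(x_1+x_2+1).$$
   Context: For a finite group $G$, $L(G)$ denotes the lattice of all subgroups of $G$ (meet $A\wedge B=A\cap B$, join $A\vee B=\langle A,B\rangle$). A diamond of $G$ is a sublattice of $L(G)$ isomorphic to the diamond lattice $M_5$ (the five-element lattice with a bottom, a top and three pairwise incomparable elements, any two of which meet in the bottom and join to the top). Equivalently, a diamond is an unordered triple $\{A,B,C\}$ of three distinct subgroups of $G$ with $A\wedge B=B\wedge C=C\wedge A$ and $A\vee B=B\vee C=C\vee A$. $dm(G)$ denotes the number of diamonds of $G$. $\mathbb{Z}_m$ denotes the cyclic group of order $m$. *)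

theory Defs
  imports Complex_Main "HOL-Computational_Algebra.Primes" "HOL-Algebra.Elementary_Groups"
begin

definition subgroup_lattice :: "('a, 'b) monoid_scheme \<Rightarrow> 'a set gorder" where
  "subgroup_lattice G = \<lparr>carrier = {H. subgroup H G}, eq = (=), le = (\<subseteq>)\<rparr>"

lemma subgroup_lattice_simps [simp]:
  "carrier (subgroup_lattice G) = {H. subgroup H G}"
  "eq (subgroup_lattice G) = (=)"
  "le (subgroup_lattice G) = (\<subseteq>)"
  by (simp_all add: subgroup_lattice_def)

lemma (in group) lattice_subgroup_lattice: "lattice (subgroup_lattice G)"
  unfolding subgroup_lattice_def by (rule complete_lattice_lattice[OF subgroups_complete_lattice])

lemma (in group) meet_subgroup_lattice:
  assumes "subgroup A G" "subgroup B G"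
  shows "A \<sqinter>\<^bsub>subgroup_lattice G\<^esub> B = A \<inter> B"
proof -
  interpret L: lattice "subgroup_lattice G" by (rule lattice_subgroup_lattice)
  have greatest: "greatest (subgroup_lattice G) (A \<inter> B) (Lower (subgroup_lattice G) {A, B})"
    using assms subgroups_Inter_pair[OF assms] by (auto simp: greatest_def Lower_def)
  show ?thesis
    by (rule L.meetI) (use assms L.greatest_unique[OF _ greatest] in auto)
qed

lemma (in group) join_subgroup_lattice:
  assumes "subgroup A G" "subgroup B G"
  shows "A \<squnion>\<^bsub>subgroup_lattice G\<^esub> B = generate G (A \<union> B)"
proof -
  interpret L: lattice "subgroup_lattice G" by (rule lattice_subgroup_lattice)
  have sub: "A \<union> B \<subseteq> carrier G"
    using assms subgroup.subset by blast
  have least: "least (subgroup_lattice G) (generate G (A \<union> B)) (Upper (subgroup_lattice G) {A, B})"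
    using assms generate_is_subgroup[OF sub] generate_subgroup_incl[of "A \<union> B"]
    by (auto simp: least_def Upper_def intro: generate.incl)
  show ?thesis
    by (rule L.joinI) (use assms L.least_unique[OF _ least] in auto)
qed

definition sublattice :: "'a set \<Rightarrow> ('a, 'b) gorder_scheme \<Rightarrow> bool" where
  "sublattice S L \<longleftrightarrow> S \<subseteq> carrier L \<and>
     (\<forall>x\<in>S. \<forall>y\<in>S. x \<sqinter>\<^bsub>L\<^esub> y \<in> S \<and> x \<squnion>\<^bsub>L\<^esub> y \<in> S)"

text \<open>Both \<^const>\<open>meet_pres\<close> and \<^const>\<open>join_pres\<close> require their two arguments to be lattices.\<close>

definition lattice_isomorphic ::
    "('a, 'c) gorder_scheme \<Rightarrow> ('b, 'd) gorder_scheme \<Rightarrow> bool" where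
  "lattice_isomorphic L M \<longleftrightarrow>
     (\<exists>h. bij_betw h (carrier L) (carrier M) \<and> meet_pres L M h \<and> join_pres L M h)"

datatype M5 = M5_bot | M5_a | M5_b | M5_c | M5_top

definition M5_lattice :: "M5 gorder" where
  "M5_lattice = \<lparr>carrier = UNIV, eq = (=), le = (\<lambda>x y. x = y \<or> x = M5_bot \<or> y = M5_top)\<rparr>"

lemma lattice_M5_lattice: "lattice M5_lattice"
proof -
  interpret partial_order M5_lattice
    by standard (auto simp: M5_lattice_def)
  show ?thesis
  proof (unfold_locales)
    fix x y :: M5
    show "\<exists>s. least M5_lattice s (Upper M5_lattice {x, y})"
      by (rule exI[of _ "if x = y \<or> y = M5_bot then x else if x = M5_bot then y else M5_top"])
        (cases x; cases y; auto simp: least_def Upper_def M5_lattice_def)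
    show "\<exists>s. greatest M5_lattice s (Lower M5_lattice {x, y})"
      by (rule exI[of _ "if x = y \<or> y = M5_top then x else if x = M5_top then y else M5_bot"])
        (cases x; cases y; auto simp: greatest_def Lower_def M5_lattice_def)
  qed
qed

text \<open>A diamond is the underlying five-element set of subgroups; the lattice operations on it
  are the ones inherited from the subgroup lattice.\<close>

definition diamond :: "('a, 'b) monoid_scheme \<Rightarrow> 'a set set \<Rightarrow> bool" where
  "diamond G D \<longleftrightarrow> sublattice D (subgroup_lattice G) \<and>
     lattice_isomorphic ((subgroup_lattice G)\<lparr>carrier := D\<rparr>) M5_lattice"

text \<open>Meaningful for finite groups, as \<^const>\<open>card\<close> is 0 on infinite sets.\<close>

definition dm :: "('a, 'b) monoid_scheme \<Rightarrow> nat" where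
  "dm G = card {D. diamond G D}"

definition f_p :: "nat \<Rightarrow> nat \<Rightarrow> nat \<Rightarrow> real" where
  "f_p p x1 x2 =
     (real x2 - real x1 + 1) * real p ^ (x1 + 2)
     - (real x2 - real x1 - 1) * real p ^ (x1 + 1)
     - (real x1 + real x2 + 3) * real p
     + (real x1 + real x2 + 1)"

end

theory Submission
  imports Defs "HOL-Library.Product_Plus" "HOL-Library.Set_Algebras" "HOL-Library.FuncSet"
begin

text \<open>Subgroups of $\mathbb{Z}_{p^{\alpha_1}} \times \mathbb{Z}_{p^{\alpha_2}}$ are the additive
  subgroups of $\mathbb{Z}^2$ containing $(p^{\alpha_1}, 0)$ and $(0, p^{\alpha_2})$. If $A, B, C$
  is a diamond with join $J$, choose a basis of $J$, so that $J$ becomes $\mathbb{Z}^2$. None of the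
  three subgroups lies in $p\mathbb{Z}^2$, since otherwise Nakayama's lemma would make the other two
  equal to $\mathbb{Z}^2$; hence each is of the form $\{z \mid p^i \text{ divides } \det(v, z)\}$ for a
  point $v$ of the projective line over $\mathbb{Z}/p^i$, the exponent $i$ is the same for all three,
  and the meet is $p^i J$. Conversely any three points of that line with distinct reductions modulo
  $p$ give a diamond, so for every $J$ and $i$ there are $\binom{p+1}{3} p^{3(i-1)}$ of them. The
  condition on $p^i J$ says that $J$ contains $(p^{\alpha_1-i}, 0)$ and $(0, p^{\alpha_2-i})$, and the
  Hermite normal form counts such $J$ as $\sum_{u \le \alpha_1-i} \sum_{v \le \alpha_2-i} p^{\min(u,v)}
  = f_p(\alpha_1-i, \alpha_2-i)/(p-1)^2$.\<close>

subsection \<open>Diamonds in a subgroup lattice\<close>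

text \<open>Subgroups of the finite group that occur as joins have varying isomorphism types. Lifted
  to the plane, every join J is the image of the plane under an injective linear map, so one
  classification serves them all. Multiplication by p^i commutes with that map, which is why the
  condition on the meet p^i J becomes the same kind of condition on J with both exponents lowered by
  i. The binomial coefficient chooses three of the p+1 points of the projective line over the field
  with p elements; each has p^(i-1) lifts modulo p^i, whence p^(3(i-1)). Since binom(p+1,3) =
  (p+1)p(p-1)/6, its factor p completes the power p^(3i-2), and its factor p-1 against the (p-1)^2
  contained in \<open>f_p\<close> leaves the constant (p+1)/(6(p-1)). No diamond is counted twice:
  the union of its members is J and their intersection is p^i J, so J, i and finally the unordered
  set of three points can be read off from it.\<close>

lemma lattice_isomorphic_if_order_iso:
  assumes L: "partial_order L" and M: "lattice M"
    and h: "bij_betw h (carrier L) (carrier M)"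
    and le: "\<And>x y. \<lbrakk>x \<in> carrier L; y \<in> carrier L\<rbrakk> \<Longrightarrow> x \<sqsubseteq>\<^bsub>L\<^esub> y \<longleftrightarrow> h x \<sqsubseteq>\<^bsub>M\<^esub> h y"
  shows "lattice_isomorphic L M"
proof -
  interpret L: partial_order L by fact
  interpret M: lattice M by fact
  define g where "g = inv_into (carrier L) h"
  have gc: "g y \<in> carrier L" and hg: "h (g y) = y" if "y \<in> carrier M" for y
    using h that unfolding g_def
    by (auto simp: bij_betw_def inv_into_into f_inv_into_f)
  have hc: "h x \<in> carrier M" if "x \<in> carrier L" for x
    using h that by (auto simp: bij_betw_def)
  \<comment> \<open>\<open>L\<close> is so far only a partial order. Pulling meets and joins back
    along the inverse \<open>g\<close> makes it a lattice, as \<open>meet_pres\<close> and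
    \<open>join_pres\<close> demand, and computes its operations at the same time.\<close>
  have gr: "greatest L (g (h x \<sqinter>\<^bsub>M\<^esub> h y)) (Lower L {x, y})"
    if xy: "x \<in> carrier L" "y \<in> carrier L" for x y
    using xy M.meet_closed[OF hc hc, OF xy] M.meet_left[OF hc hc, OF xy] M.meet_right[OF hc hc, OF xy]
      M.meet_le[OF _ _ hc hc hc, of _ x y]
    by (auto simp: greatest_def Lower_def le gc hg)
  have ls: "least L (g (h x \<squnion>\<^bsub>M\<^esub> h y)) (Upper L {x, y})"
    if xy: "x \<in> carrier L" "y \<in> carrier L" for x y
    using xy M.join_closed[OF hc hc, OF xy] M.join_left[OF hc hc, OF xy] M.join_right[OF hc hc, OF xy]
      M.join_le[OF _ _ hc hc hc, of x _ y]
    by (auto simp: least_def Upper_def le gc hg)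
  interpret L: lattice L
    by unfold_locales (use gr ls in blast)+
  have "h (x \<sqinter>\<^bsub>L\<^esub> y) = h x \<sqinter>\<^bsub>M\<^esub> h y" if xy: "x \<in> carrier L" "y \<in> carrier L" for x y
  proof (rule L.meetI[OF _ xy])
    fix i assume "greatest L i (Lower L {x, y})"
    then have "i = g (h x \<sqinter>\<^bsub>M\<^esub> h y)" using L.greatest_unique gr[OF xy] by blast
    then show "h i = h x \<sqinter>\<^bsub>M\<^esub> h y" using hg M.meet_closed[OF hc hc, OF xy] by blast
  qed
  moreover have "h (x \<squnion>\<^bsub>L\<^esub> y) = h x \<squnion>\<^bsub>M\<^esub> h y" if xy: "x \<in> carrier L" "y \<in> carrier L" for x y
  proof (rule L.joinI[OF _ xy])
    fix i assume "least L i (Upper L {x, y})"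
    then have "i = g (h x \<squnion>\<^bsub>M\<^esub> h y)" using L.least_unique ls[OF xy] by blast
    then show "h i = h x \<squnion>\<^bsub>M\<^esub> h y" using hg M.join_closed[OF hc hc, OF xy] by blast
  qed
  ultimately show ?thesis
    unfolding lattice_isomorphic_def meet_pres_def join_pres_def
    using h L.lattice_axioms M by blast
qed

text \<open>In a lattice x lies below y iff their meet is x, so an injection that preserves meets
  both preserves and reflects the order.\<close>

lemma lattice_isomorphicE:
  assumes "lattice_isomorphic L M"
  obtains h where "bij_betw h (carrier L) (carrier M)"
    "\<And>x y. \<lbrakk>x \<in> carrier L; y \<in> carrier L\<rbrakk> \<Longrightarrow> x \<sqsubseteq>\<^bsub>L\<^esub> y \<longleftrightarrow> h x \<sqsubseteq>\<^bsub>M\<^esub> h y"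
proof -
  obtain h where h: "bij_betw h (carrier L) (carrier M)" and m: "meet_pres L M h"
    using assms by (auto simp: lattice_isomorphic_def)
  interpret L: lattice L using m by (simp add: meet_pres_def)
  interpret M: lattice M using m by (simp add: meet_pres_def)
  have "x \<sqsubseteq>\<^bsub>L\<^esub> y \<longleftrightarrow> h x \<sqsubseteq>\<^bsub>M\<^esub> h y" if xy: "x \<in> carrier L" "y \<in> carrier L" for x y
  proof -
    have hc: "h x \<in> carrier M" "h y \<in> carrier M"
      using h xy by (auto simp: bij_betw_def)
    \<comment> \<open>Despite its name, \<open>le_iff_join\<close> expresses the order through the
      meet.\<close>
    have "x \<sqsubseteq>\<^bsub>L\<^esub> y \<longleftrightarrow> x \<sqinter>\<^bsub>L\<^esub> y = x"
      using L.le_iff_join[OF xy] by auto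
    also have "\<dots> \<longleftrightarrow> h (x \<sqinter>\<^bsub>L\<^esub> y) = h x"
      using h xy by (auto simp: bij_betw_def inj_on_def)
    also have "\<dots> \<longleftrightarrow> h x \<sqinter>\<^bsub>M\<^esub> h y = h x"
      using m xy by (simp add: meet_pres_def)
    also have "\<dots> \<longleftrightarrow> h x \<sqsubseteq>\<^bsub>M\<^esub> h y"
      using M.le_iff_join[OF hc] by auto
    finally show ?thesis .
  qed
  then show thesis using h that by blast
qed

text \<open>From left to right, closure of \<open>D\<close> puts the meet and join of two atoms back
  into \<open>D\<close>, and the order of \<open>M5\<close> leaves only bottom and top for them.
  From right to left, the work is to show that three distinct subgroups with common meets and joins
  are incomparable, so that all five members differ.\<close>

lemma (in group) diamond_iff:
  "diamond G D \<longleftrightarrow>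
    (\<exists>A B C. subgroup A G \<and> subgroup B G \<and> subgroup C G \<and> A \<noteq> B \<and> B \<noteq> C \<and> A \<noteq> C \<and>
       A \<inter> B = B \<inter> C \<and> A \<inter> C = B \<inter> C \<and>
       generate G (A \<union> B) = generate G (B \<union> C) \<and> generate G (A \<union> C) = generate G (B \<union> C) \<and>
       D = {A \<inter> B, A, B, C, generate G (A \<union> B)})" (is "_ \<longleftrightarrow> (\<exists>A B C. ?P A B C)")
proof
  assume D: "diamond G D"
  have sub: "subgroup X G" if "X \<in> D" for X
    using D that by (auto simp: diamond_def sublattice_def)
  have cl: "X \<inter> Y \<in> D" "generate G (X \<union> Y) \<in> D" if "X \<in> D" "Y \<in> D" for X Y
    using D that meet_subgroup_lattice[OF sub sub, OF that] join_subgroup_lattice[OF sub sub, OF that]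
    unfolding diamond_def sublattice_def by metis+
  obtain h where h: "bij_betw h D (UNIV :: M5 set)"
    and le: "\<And>X Y. \<lbrakk>X \<in> D; Y \<in> D\<rbrakk> \<Longrightarrow> X \<subseteq> Y \<longleftrightarrow> h X = h Y \<or> h X = M5_bot \<or> h Y = M5_top"
    using D unfolding diamond_def
    by (elim conjE lattice_isomorphicE) (auto simp: M5_lattice_def)
  define g where "g = inv_into D h"
  have g: "g y \<in> D" "h (g y) = y" for y
    using h unfolding g_def by (auto simp: bij_betw_def inv_into_into f_inv_into_f)
  have gh: "g (h X) = X" if "X \<in> D" for X
    using h that by (auto simp: g_def bij_betw_def)
  have gle: "g x \<subseteq> g y \<longleftrightarrow> x = y \<or> x = M5_bot \<or> y = M5_top" for x y
    using le[OF g(1) g(1)] by (simp add: g)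
  have geq: "g x = g y \<longleftrightarrow> x = y" for x y
    by (metis g(2))
  have int: "g x \<inter> g y = g M5_bot"
    if "x \<noteq> y" "x \<notin> {M5_bot, M5_top}" "y \<notin> {M5_bot, M5_top}" for x y
  proof -
    obtain m where m: "g x \<inter> g y = g m" using cl(1)[OF g(1) g(1)] gh by metis
    then have "g m \<subseteq> g x" "g m \<subseteq> g y" by auto
    then have "m = M5_bot" using that by (auto simp: gle)
    then show ?thesis using m by simp
  qed
  have gen: "generate G (g x \<union> g y) = g M5_top"
    if "x \<noteq> y" "x \<notin> {M5_bot, M5_top}" "y \<notin> {M5_bot, M5_top}" for x y
  proof -
    obtain m where m: "generate G (g x \<union> g y) = g m" using cl(2)[OF g(1) g(1)] gh by metis
    then have "g x \<subseteq> g m" "g y \<subseteq> g m" by (metis UnCI generate.incl subsetI)+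
    then have "m = M5_top" using that by (auto simp: gle)
    then show ?thesis using m by simp
  qed
  have "D = g ` UNIV" using g gh by (auto simp: image_iff) metis
  also have "(UNIV :: M5 set) = {M5_bot, M5_a, M5_b, M5_c, M5_top}"
    using M5.exhaust by blast
  finally have "D = {g M5_bot, g M5_a, g M5_b, g M5_c, g M5_top}" by simp
  then have "?P (g M5_a) (g M5_b) (g M5_c)"
    using sub g(1) by (simp add: geq int gen)
  then show "\<exists>A B C. ?P A B C" by blast
next
  assume "\<exists>A B C. ?P A B C"
  then obtain A B C where P: "?P A B C" by blast
  define b t where "b = A \<inter> B" and "t = generate G (A \<union> B)"
  have sub: "subgroup A G" "subgroup B G" "subgroup C G" "subgroup b G" "subgroup t G"
    using P subgroups_Inter_pair subgroup.subset[of _ G] generate_is_subgroup[of "A \<union> B"]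
    by (auto simp: b_def t_def)
  have ne: "A \<noteq> B" "B \<noteq> C" "A \<noteq> C" using P by auto
  have int: "A \<inter> B = b" "B \<inter> A = b" "B \<inter> C = b" "C \<inter> B = b" "A \<inter> C = b" "C \<inter> A = b"
    using P by (auto simp: b_def)
  have gen: "generate G (A \<union> B) = t" "generate G (B \<union> C) = t" "generate G (A \<union> C) = t"
    using P by (auto simp: t_def)
  have gen': "generate G (B \<union> A) = t" "generate G (C \<union> B) = t" "generate G (C \<union> A) = t"
    using gen by (simp_all add: Un_commute)
  have self: "generate G X = X" if "subgroup X G" for X
    using that generate_subgroup_incl[of X X] by (auto intro: generate.incl)
  have nb: "b \<noteq> A" "b \<noteq> B" "b \<noteq> C"
  proof -
    \<comment> \<open>If X lies in Y, then X is the common meet b and Y the common join t. Since b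
      lies in Z, the join of X and Z is Z, so Z = t = Y, a contradiction.\<close>
    have "\<not> X \<subseteq> Y" if "subgroup X G" "subgroup Y G" "X \<noteq> Y" "Y \<noteq> Z"
      "generate G (X \<union> Y) = t" "generate G (X \<union> Z) = t" "Y \<inter> Z = b" "X \<inter> Y = b" "subgroup Z G" for X Y Z
    proof
      assume "X \<subseteq> Y"
      then have "X \<union> Y = Y" "X = b" using that by auto
      then have "Y = t" "X \<union> Z = Z" using that self by auto
      then have "Z = t" using that self by auto
      then show False using \<open>Y = t\<close> that by simp
    qed
    note * = this
    have "\<not> A \<subseteq> B" "\<not> B \<subseteq> A" "\<not> C \<subseteq> A"
      using *[of A B C] *[of B A C] *[of C A B] sub ne gen gen' int by metis+
    then show "b \<noteq> A" "b \<noteq> B" "b \<noteq> C" using int by blast+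
  qed
  have up: "A \<subseteq> t" "B \<subseteq> t" "C \<subseteq> t"
    using gen by (metis UnCI generate.incl subsetI)+
  have ninc1: "\<not> A \<subseteq> B" "\<not> B \<subseteq> A" "\<not> A \<subseteq> C" "\<not> C \<subseteq> A" "\<not> B \<subseteq> C" "\<not> C \<subseteq> B"
    using int nb by (metis inf.orderE)+
  have nt: "t \<noteq> A" "t \<noteq> B" "t \<noteq> C"
    using up ninc1 by metis+
  have nbt: "b \<noteq> t"
    using up int nb by (metis inf.absorb_iff2 inf_commute inf_left_idem)
  have lo: "b \<subseteq> A" "b \<subseteq> B" "b \<subseteq> C" "b \<subseteq> t"
    using int up by (metis Int_lower1 Int_lower2 subset_trans)+
  have bt: "A \<union> t = t" "t \<union> A = t" "B \<union> t = t" "t \<union> B = t" "C \<union> t = t" "t \<union> C = t" "b \<union> t = t" "t \<union> b = t"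
    "A \<union> b = A" "b \<union> A = A" "B \<union> b = B" "b \<union> B = B" "C \<union> b = C" "b \<union> C = C"
    using up lo by (simp_all add: Un_absorb1 Un_absorb2)
  have bt': "A \<inter> t = A" "t \<inter> A = A" "B \<inter> t = B" "t \<inter> B = B" "C \<inter> t = C" "t \<inter> C = C" "b \<inter> t = b" "t \<inter> b = b"
    "A \<inter> b = b" "b \<inter> A = b" "B \<inter> b = b" "b \<inter> B = b" "C \<inter> b = b" "b \<inter> C = b"
    using up lo by (simp_all add: Int_absorb1 Int_absorb2)
  have ninc2: "\<not> A \<subseteq> b" "\<not> B \<subseteq> b" "\<not> C \<subseteq> b" "\<not> t \<subseteq> A" "\<not> t \<subseteq> B" "\<not> t \<subseteq> C" "\<not> t \<subseteq> b"
    using nb nt up lo nbt by (metis subset_antisym)+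
  have D: "D = {b, A, B, C, t}" using P by (simp add: b_def t_def)
  have "sublattice D (subgroup_lattice G)"
    unfolding sublattice_def
  proof (intro conjI ballI)
    show "D \<subseteq> carrier (subgroup_lattice G)" using sub D by auto
    fix X Y assume XY: "X \<in> D" "Y \<in> D"
    then have s: "subgroup X G" "subgroup Y G" using sub D by auto
    have "X \<inter> Y \<in> {b, A, B, C, t} \<and> generate G (X \<union> Y) \<in> {b, A, B, C, t}"
      using XY unfolding D insert_iff empty_iff
      by (elim disjE) (simp_all add: int gen gen' bt bt' sub[THEN self])
    then show "X \<sqinter>\<^bsub>subgroup_lattice G\<^esub> Y \<in> D" "X \<squnion>\<^bsub>subgroup_lattice G\<^esub> Y \<in> D"
      unfolding meet_subgroup_lattice[OF s] join_subgroup_lattice[OF s] D by simp_all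
  qed
  moreover have "lattice_isomorphic ((subgroup_lattice G)\<lparr>carrier := D\<rparr>) M5_lattice"
  proof (rule lattice_isomorphic_if_order_iso)
    show "partial_order ((subgroup_lattice G)\<lparr>carrier := D\<rparr>)"
      by standard auto
    show "lattice M5_lattice" by (rule lattice_M5_lattice)
    define h where "h X = (if X = b then M5_bot else if X = A then M5_a else if X = B then M5_b
      else if X = C then M5_c else M5_top)" for X
    have hs: "h b = M5_bot" "h A = M5_a" "h B = M5_b" "h C = M5_c" "h t = M5_top"
      using ne nb nt nbt by (auto simp: h_def)
    have "(UNIV :: M5 set) = {M5_bot, M5_a, M5_b, M5_c, M5_top}"
      using M5.exhaust by blast
    then show "bij_betw h (carrier ((subgroup_lattice G)\<lparr>carrier := D\<rparr>)) (carrier M5_lattice)"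
      by (auto simp: bij_betw_def D hs inj_on_def M5_lattice_def)
    show "X \<sqsubseteq>\<^bsub>(subgroup_lattice G)\<lparr>carrier := D\<rparr>\<^esub> Y \<longleftrightarrow> h X \<sqsubseteq>\<^bsub>M5_lattice\<^esub> h Y"
      if "X \<in> carrier ((subgroup_lattice G)\<lparr>carrier := D\<rparr>)"
        "Y \<in> carrier ((subgroup_lattice G)\<lparr>carrier := D\<rparr>)" for X Y
    proof -
      have "X \<in> {b, A, B, C, t}" "Y \<in> {b, A, B, C, t}" using that by (simp_all add: D)
      then have "X \<subseteq> Y \<longleftrightarrow> h X = h Y \<or> h X = M5_bot \<or> h Y = M5_top"
        unfolding insert_iff empty_iff
        by (elim disjE) (simp_all add: hs ninc1 ninc2 lo up)
      then show ?thesis by (simp add: subgroup_lattice_def M5_lattice_def)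
    qed
  qed
  ultimately show "diamond G D" unfolding diamond_def by simp
qed

subsection \<open>Sublattices of the integer plane\<close>

text \<open>Subgroups of the plane of any rank; finite index enters only through the axis multiples
  \<open>(p ^ a, 0)\<close> and \<open>(0, p ^ b)\<close>.\<close>

definition lat :: "(int \<times> int) set \<Rightarrow> bool" where
  "lat L \<longleftrightarrow> 0 \<in> L \<and> (\<forall>x\<in>L. \<forall>y\<in>L. x - y \<in> L)"

definition smul :: "int \<Rightarrow> int \<times> int \<Rightarrow> int \<times> int" where
  "smul k z = (k * fst z, k * snd z)"

lemma fst_smul [simp]: "fst (smul k z) = k * fst z"
  and snd_smul [simp]: "snd (smul k z) = k * snd z"
  by (simp_all add: smul_def)

lemma lat_zero: "lat L \<Longrightarrow> 0 \<in> L"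
  by (simp add: lat_def)

lemma lat_diff: "\<lbrakk>lat L; x \<in> L; y \<in> L\<rbrakk> \<Longrightarrow> x - y \<in> L"
  by (simp add: lat_def)

lemma lat_uminus: "\<lbrakk>lat L; x \<in> L\<rbrakk> \<Longrightarrow> - x \<in> L"
  using lat_diff[of L 0 x] lat_zero by simp

lemma lat_add: "\<lbrakk>lat L; x \<in> L; y \<in> L\<rbrakk> \<Longrightarrow> x + y \<in> L"
  using lat_diff[of L x "- y"] lat_uminus by simp

lemma lat_smul:
  assumes "lat L" "z \<in> L"
  shows "smul k z \<in> L"
proof -
  have nat: "smul (int n) z \<in> L" for n
  proof (induction n)
    case 0
    then show ?case using lat_zero[OF assms(1)] by (simp add: smul_def zero_prod_def)
  next
    case (Suc n)
    have "smul (int (Suc n)) z = smul (int n) z + z"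
      by (simp add: prod_eq_iff algebra_simps)
    then show ?case using Suc assms lat_add by simp
  qed
  show ?thesis
  proof (cases "k \<ge> 0")
    case True
    then show ?thesis using nat[of "nat k"] by simp
  next
    case False
    have "smul k z = - smul (int (nat (- k))) z"
      using False by (simp add: prod_eq_iff)
    then show ?thesis using nat lat_uminus[OF assms(1)] by metis
  qed
qed

lemma lat_plus:
  assumes "lat A" "lat B"
  shows "lat (A + B)"
  unfolding lat_def
proof (intro conjI ballI)
  show "0 \<in> A + B"
    using assms set_plus_intro[of 0 A 0 B] by (simp add: lat_zero)
  fix x y assume "x \<in> A + B" "y \<in> A + B"
  then obtain a b a' b' where "a \<in> A" "b \<in> B" "x = a + b" "a' \<in> A" "b' \<in> B" "y = a' + b'"
    by (meson set_plus_elim)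
  moreover have "a + b - (a' + b') = (a - a') + (b - b')" by (simp add: prod_eq_iff)
  ultimately show "x - y \<in> A + B"
    using assms lat_diff set_plus_intro by metis
qed

lemma lat_subset_plus:
  assumes "lat A" "lat B"
  shows "A \<subseteq> A + B" "B \<subseteq> A + B"
  using set_plus_intro[of _ A 0 B] set_plus_intro[of 0 A _ B] lat_zero assms by fastforce+

text \<open>Division with remainder by the least positive element; d = 0 covers the zero
  subgroup.\<close>

lemma int_subgroup_multiples:
  fixes S :: "int set"
  assumes zero: "0 \<in> S" and diff: "\<And>x y. \<lbrakk>x \<in> S; y \<in> S\<rbrakk> \<Longrightarrow> x - y \<in> S"
  obtains d where "S = {k. d dvd k}"
proof -
  have neg: "- x \<in> S" if "x \<in> S" for x
    using diff[OF zero that] by simp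
  have add: "x + y \<in> S" if "x \<in> S" "y \<in> S" for x y
    using diff[OF that(1) neg[OF that(2)]] by simp
  have natmul: "int n * x \<in> S" if "x \<in> S" for n x
    by (induction n) (use zero add that in \<open>auto simp: algebra_simps\<close>)
  have mul: "k * x \<in> S" if "x \<in> S" for k x
    using natmul[OF that, of "nat k"] neg[OF natmul[OF that, of "nat (- k)"]]
    by (cases "k \<ge> 0") auto
  show thesis
  proof (cases "S = {0}")
    case True
    then show thesis using that[of 0] by auto
  next
    case False
    then obtain x where "x \<in> S" "x \<noteq> 0" using zero by blast
    then have ex: "\<exists>n>0. int n \<in> S"
      using neg[of x] by (intro exI[of _ "nat \<bar>x\<bar>"]) (auto simp: abs_if)
    define d where "d = (LEAST n. n > 0 \<and> int n \<in> S)"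
    have d: "d > 0" "int d \<in> S" using LeastI_ex[OF ex] by (auto simp: d_def)
    have "int d dvd k" if "k \<in> S" for k
    proof -
      have "k - (k div int d) * int d \<in> S" using diff[OF that mul[OF d(2)]] .
      then have m: "k mod int d \<in> S" by (simp add: minus_div_mult_eq_mod)
      have "k mod int d < int d" "0 \<le> k mod int d" using d by auto
      moreover have "nat (k mod int d) = 0"
      proof (rule ccontr)
        assume "nat (k mod int d) \<noteq> 0"
        then have "d \<le> nat (k mod int d)"
          using m d(1) Least_le[of "\<lambda>n. n > 0 \<and> int n \<in> S" "nat (k mod int d)", folded d_def]
          by simp
        then show False using \<open>k mod int d < int d\<close> d(1) by arith
      qed
      ultimately have "k mod int d = 0" by arith
      then show ?thesis by (rule mod_0_imp_dvd)
    qed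
    then show thesis using that[of "int d"] mul[OF d(2)] by (auto simp: dvd_def mult.commute)
  qed
qed

lemma int_subgroup_prime_power:
  fixes S :: "int set"
  assumes "prime p" "0 \<in> S" "\<And>x y. \<lbrakk>x \<in> S; y \<in> S\<rbrakk> \<Longrightarrow> x - y \<in> S" "p ^ n \<in> S"
  obtains k where "k \<le> n" "S = {m. p ^ k dvd m}"
proof -
  obtain d where d: "S = {k. d dvd k}" using int_subgroup_multiples assms(2,3) by metis
  then have "d dvd p ^ n" using assms by simp
  then obtain k where "k \<le> n" "normalize d = normalize (p ^ k)"
    using divides_primepow_weak[OF assms(1)] by metis
  then have "d dvd m \<longleftrightarrow> p ^ k dvd m" for m
    by (metis associated_iff_dvd dvd_trans)
  then show thesis using that \<open>k \<le> n\<close> d by simp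
qed

section \<open>Sublattices cut out by a determinant modulo q\<close>

definition det2 :: "int \<times> int \<Rightarrow> int \<times> int \<Rightarrow> int" where
  "det2 v w = fst v * snd w - snd v * fst w"

text \<open>If a coordinate of v is 1, this is the sublattice generated by v and q times the plane,
  with cyclic quotient of order q. Writing it as the kernel of a linear form modulo q turns
  membership into a divisibility.\<close>

definition cyclat :: "int \<Rightarrow> int \<times> int \<Rightarrow> (int \<times> int) set" where
  "cyclat q v = {z. q dvd det2 v z}"

lemma lat_cyclat: "lat (cyclat q v)"
proof -
  have "det2 v (x - y) = det2 v x - det2 v y" for x y
    by (simp add: det2_def algebra_simps)
  then show ?thesis by (simp add: lat_def cyclat_def) (simp add: det2_def)
qed

lemma smul_mem_cyclat: "smul q z \<in> cyclat q v"
  by (simp add: cyclat_def det2_def mult.left_commute[of _ q] flip: right_diff_distrib)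

lemma mem_cyclat_self: "smul k v \<in> cyclat q v"
  by (simp add: cyclat_def det2_def)

lemma coprime_bezout_int:
  fixes a b :: int
  assumes "coprime a b"
  obtains u w where "u * a + w * b = 1"
  using bezout_int[of a b] assms by (auto simp: coprime_iff_gcd_eq_1)

text \<open>Cramer's rule, with the determinant left as a factor because it is in general no unit of
  the integers.\<close>

lemma det2_expand: "smul (det2 v w) z = smul (det2 z w) v + smul (det2 v z) w"
  by (simp add: prod_eq_iff det2_def algebra_simps)

text \<open>For z in both sublattices, q divides both coefficients in Cramer's rule, hence
  \<open>det2 v w\<close> times z; the determinant is a unit modulo q, so q divides z.\<close>

lemma cyclat_Int:
  assumes "coprime q (det2 v w)"
  shows "cyclat q v \<inter> cyclat q w = range (smul q)"
proof
  show "range (smul q) \<subseteq> cyclat q v \<inter> cyclat q w"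
    by (intro subsetI) (use smul_mem_cyclat in blast)
  show "cyclat q v \<inter> cyclat q w \<subseteq> range (smul q)"
  proof
    fix z assume "z \<in> cyclat q v \<inter> cyclat q w"
    then have "q dvd det2 v z" "q dvd det2 w z" by (auto simp: cyclat_def)
    moreover have "det2 z w = - det2 w z" by (simp add: det2_def)
    ultimately have "q dvd det2 v w * fst z" "q dvd det2 v w * snd z"
      using det2_expand[of v w z] by (auto simp: prod_eq_iff)
    then have "q dvd fst z" "q dvd snd z"
      using assms coprime_dvd_mult_right_iff by blast+
    then show "z \<in> range (smul q)"
      by (auto simp: dvd_def image_iff prod_eq_iff)
  qed
qed

text \<open>Split z by a Bezout identity for q and \<open>det2 v w\<close>: the determinant part is
  a combination of v and w by Cramer's rule, and the multiple of q lies in either summand.\<close>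

lemma cyclat_plus:
  assumes "coprime q (det2 v w)"
  shows "cyclat q v + cyclat q w = UNIV"
proof -
  obtain u r where ur: "u * q + r * det2 v w = 1"
    using coprime_bezout_int assms by metis
  have "z \<in> cyclat q v + cyclat q w" for z
  proof -
    have "smul r (smul (det2 v w) z) = smul (r * det2 z w) v + smul (r * det2 v z) w"
      unfolding det2_expand[of v w z] by (simp add: prod_eq_iff algebra_simps)
    moreover have "z = smul (u * q + r * det2 v w) z"
      unfolding ur by (simp add: prod_eq_iff)
    ultimately have "z = smul (r * det2 z w) v + (smul (r * det2 v z) w + smul q (smul u z))"
      by (simp add: prod_eq_iff algebra_simps)
    then show ?thesis
      using mem_cyclat_self smul_mem_cyclat lat_add[OF lat_cyclat] set_plus_intro by metis
  qed
  then show ?thesis by auto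
qed

text \<open>Substituting the hypothesis into itself k times writes every z as an element of
  \<open>B\<close> plus a multiple of p^k; for k = n that multiple is in \<open>B\<close> as
  well.\<close>

lemma nakayama_lat:
  assumes B: "lat B" "\<And>z. smul (p ^ n) z \<in> B" and sum: "B + range (smul p) = UNIV"
  shows "B = UNIV"
proof -
  have "\<exists>b\<in>B. \<exists>w. z = b + smul (p ^ k) w" for k z
  proof (induction k arbitrary: z)
    case 0
    have "z = 0 + smul (p ^ 0) z" by (simp add: prod_eq_iff)
    then show ?case using lat_zero[OF B(1)] by blast
  next
    case (Suc k)
    obtain b w where b: "b \<in> B" "z = b + smul (p ^ k) w" using Suc by blast
    have "w \<in> B + range (smul p)" using sum by simp
    then obtain b' x where "b' \<in> B" "x \<in> range (smul p)" "w = b' + x" by (rule set_plus_elim)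
    then obtain w' where b': "b' \<in> B" "w = b' + smul p w'" by blast
    have "z = (b + smul (p ^ k) b') + smul (p ^ Suc k) w'"
      using b b' by (simp add: prod_eq_iff algebra_simps)
    moreover have "b + smul (p ^ k) b' \<in> B" using b b' lat_add lat_smul B(1) by blast
    ultimately show ?case by blast
  qed
  from this[of _ n] show ?thesis using B lat_add by (metis UNIV_eq_I)
qed

text \<open>Representatives of the points of the projective line over $\mathbb{Z}/p^i$, for $i \ge 1$.\<close>

definition reps :: "int \<Rightarrow> nat \<Rightarrow> (int \<times> int) set" where
  "reps p i = (\<lambda>t. (1, t)) ` {0..<p ^ i} \<union> (\<lambda>s. (p * s, 1)) ` {0..<p ^ (i - 1)}"

text \<open>The reduction modulo $p$ of a point of \<open>reps p i\<close>; the point at infinity is encoded as $p$.\<close>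

definition residue_class :: "int \<Rightarrow> int \<times> int \<Rightarrow> int" where
  "residue_class p v = (if p dvd fst v then p else snd v mod p)"

lemma swap_image_lat:
  assumes "lat A"
  shows "lat (prod.swap ` A)"
  unfolding lat_def
proof (intro conjI ballI)
  show "0 \<in> prod.swap ` A"
    using lat_zero[OF assms] by (force simp: zero_prod_def)
  fix x y assume "x \<in> prod.swap ` A" "y \<in> prod.swap ` A"
  then obtain a b where "a \<in> A" "x = prod.swap a" "b \<in> A" "y = prod.swap b" by blast
  moreover have "prod.swap a - prod.swap b = prod.swap (a - b)" by (simp add: prod_eq_iff)
  ultimately show "x - y \<in> prod.swap ` A" using lat_diff[OF assms] by auto
qed

text \<open>\<open>fst v\<close> is a unit modulo p^n, so a multiple of \<open>v\<close>, corrected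
  by an element of p^n times the plane, has the form (1, t). Subtracting multiples of (1, t) moves
  any vector to the vertical axis, where \<open>A\<close> consists of the multiples of some
  p^k.\<close>

lemma lat_eq_cyclat_fst:
  assumes p: "prime p" and A: "lat A" "\<And>z. smul (p ^ n) z \<in> A"
    and v: "v \<in> A" "\<not> p dvd fst v"
  obtains k t where "k \<le> n" "A = cyclat (p ^ k) (1, t)"
proof -
  have "coprime (fst v) (p ^ n)"
    using p v(2) by (simp add: prime_imp_coprime coprime_commute)
  then obtain u w where uw: "u * fst v + w * p ^ n = 1" using coprime_bezout_int by metis
  define t where "t = u * snd v"
  have "smul u v + smul (p ^ n) (w, 0) = (1, t)"
    using uw by (simp add: prod_eq_iff t_def mult.commute)
  then have 1: "(1, t) \<in> A" using A v lat_add lat_smul by metis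
  define S where "S = {m. (0, m) \<in> A}"
  obtain k where k: "k \<le> n" "S = {m. p ^ k dvd m}"
  proof (rule int_subgroup_prime_power[OF p, of S n])
    show "0 \<in> S" using lat_zero[OF A(1)] by (simp add: S_def zero_prod_def)
    show "x - y \<in> S" if "x \<in> S" "y \<in> S" for x y
      using lat_diff[OF A(1), of "(0, x)" "(0, y)"] that by (simp add: S_def minus_prod_def)
    show "p ^ n \<in> S" using A(2)[of "(0, 1)"] by (simp add: S_def smul_def)
  qed
  have "z \<in> A \<longleftrightarrow> z \<in> cyclat (p ^ k) (1, t)" for z
  proof -
    have eq: "z = (0, snd z - t * fst z) + smul (fst z) (1, t)"
      by (simp add: prod_eq_iff algebra_simps)
    have "z \<in> A \<longleftrightarrow> (0, snd z - t * fst z) \<in> A"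
      using lat_diff[OF A(1) _ lat_smul[OF A(1) 1, of "fst z"], of z]
        lat_add[OF A(1) _ lat_smul[OF A(1) 1, of "fst z"], of "(0, snd z - t * fst z)"] eq
      by (metis add_diff_cancel_right')
    also have "\<dots> \<longleftrightarrow> snd z - t * fst z \<in> S" by (simp add: S_def)
    also have "\<dots> \<longleftrightarrow> z \<in> cyclat (p ^ k) (1, t)"
      unfolding k by (simp add: cyclat_def det2_def)
    finally show ?thesis .
  qed
  then show thesis using that[OF k(1)] by blast
qed

lemma cyclat_cong:
  assumes "q dvd fst v - fst w" "q dvd snd v - snd w"
  shows "cyclat q v = cyclat q w"
proof -
  have "q dvd det2 v z - det2 w z" for z
  proof -
    have "det2 v z - det2 w z = (fst v - fst w) * snd z - (snd v - snd w) * fst z"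
      by (simp add: det2_def algebra_simps)
    then show ?thesis using assms by simp
  qed
  then have "q dvd det2 v z \<longleftrightarrow> q dvd det2 w z" for z
    using dvd_diff_left_iff by (metis dvd_diff_commute dvd_diff_right_iff)
  then show ?thesis by (simp add: cyclat_def)
qed

text \<open>Some element of \<open>A\<close> has a coordinate prime to p. If it is the first one,
  the previous lemma applies; otherwise it applies after exchanging the axes. Properness of
  \<open>A\<close> excludes k = 0.\<close>

lemma lat_eq_cyclat:
  assumes p: "prime p" and A: "lat A" "\<And>z. smul (p ^ n) z \<in> A" "A \<noteq> UNIV"
    and v: "\<not> A \<subseteq> range (smul p)"
  obtains k w where "1 \<le> k" "w \<in> reps p k" "A = cyclat (p ^ k) w"
proof -
  have pos: "p > 0" using p prime_gt_0_int by blast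
  obtain v where v: "v \<in> A" "\<not> (p dvd fst v \<and> p dvd snd v)"
    using v by (force simp: dvd_def image_iff prod_eq_iff)
  show thesis
  proof (cases "\<exists>v\<in>A. \<not> p dvd fst v")
    case True
    then obtain k t where k: "A = cyclat (p ^ k) (1, t)"
      using lat_eq_cyclat_fst[OF p A(1,2)] by metis
    then have "k \<noteq> 0" using A(3) by (metis UNIV_eq_I one_dvd power_0 cyclat_def mem_Collect_eq)
    have "A = cyclat (p ^ k) (1, t mod p ^ k)"
      unfolding k by (rule cyclat_cong) (simp_all add: minus_mod_eq_mult_div)
    moreover have "(1, t mod p ^ k) \<in> reps p k" using pos by (simp add: reps_def)
    ultimately show thesis using that \<open>k \<noteq> 0\<close> by (metis One_nat_def Suc_leI not_gr0)
  next
    case False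
    have swp: "smul (p ^ n) z \<in> prod.swap ` A" for z
    proof -
      have "smul (p ^ n) z = prod.swap (smul (p ^ n) (prod.swap z))" by (simp add: prod_eq_iff)
      then show ?thesis using A(2) by blast
    qed
    obtain k s where k: "prod.swap ` A = cyclat (p ^ k) (1, s)"
      using lat_eq_cyclat_fst[OF p swap_image_lat[OF A(1)] swp, of "prod.swap v"] v False
      by (metis fst_swap image_eqI)
    have "z \<in> A \<longleftrightarrow> z \<in> cyclat (p ^ k) (s, 1)" for z
    proof -
      have "z \<in> A \<longleftrightarrow> prod.swap z \<in> prod.swap ` A" by (metis image_iff swap_swap)
      also have "\<dots> \<longleftrightarrow> p ^ k dvd fst z - s * snd z"
        unfolding k by (simp add: cyclat_def det2_def)
      also have "\<dots> \<longleftrightarrow> z \<in> cyclat (p ^ k) (s, 1)"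
        by (simp add: cyclat_def det2_def dvd_diff_commute)
      finally show ?thesis .
    qed
    then have k': "A = cyclat (p ^ k) (s, 1)" by blast
    then have "k \<noteq> 0" using A(3) by (metis UNIV_eq_I one_dvd power_0 cyclat_def mem_Collect_eq)
    \<comment> \<open>All first coordinates in \<open>A\<close> are divisible by p in this case; for
      the element (s, 1) this gives the shape of the second family in \<open>reps\<close>. As s = p
      s' matters modulo p^k, s' matters only modulo p^(k-1).\<close>
    have "(s, 1) \<in> A" using mem_cyclat_self[of 1 "(s, 1)" "p ^ k"] unfolding k' by (simp add: smul_def)
    then have "p dvd s" using False by auto
    then obtain s' where s': "s = p * s'" by blast
    have pk: "p ^ k = p * p ^ (k - 1)" using \<open>k \<noteq> 0\<close> by (metis power_eq_if)
    have "A = cyclat (p ^ k) (p * (s' mod p ^ (k - 1)), 1)"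
      unfolding k' s'
    proof (rule cyclat_cong)
      have "p * s' - p * (s' mod p ^ (k - 1)) = p * (p ^ (k - 1) * (s' div p ^ (k - 1)))"
        by (simp add: minus_mod_eq_mult_div flip: right_diff_distrib)
      then show "p ^ k dvd fst (p * s', 1) - fst (p * (s' mod p ^ (k - 1)), 1)"
        unfolding pk by simp
    qed simp
    moreover have "(p * (s' mod p ^ (k - 1)), 1) \<in> reps p k" using pos by (simp add: reps_def)
    ultimately show thesis using that \<open>k \<noteq> 0\<close> by (metis One_nat_def Suc_leI not_gr0)
  qed
qed

text \<open>A determinant vanishes modulo p iff the two vectors are proportional there, that is,
  represent the same point of the projective line over the field with p elements. The levels i and j
  may differ, so this applies before the exponents of the three subgroups are known to
  agree.\<close>

lemma prime_dvd_det2_iff: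
  assumes p: "prime p" and v: "v \<in> reps p i" and w: "w \<in> reps p j"
  shows "p dvd det2 v w \<longleftrightarrow> residue_class p v = residue_class p w"
proof -
  have p1: "\<not> p dvd 1" using p not_prime_unit by blast
  have pos: "p > 0" using p prime_gt_0_int by blast
  then have ne: "x mod p \<noteq> p" "p \<noteq> x mod p" for x by (metis pos_mod_bound less_irrefl)+
  have 1: "\<not> p dvd 1 - x * p" "\<not> p dvd 1 - p * x" "\<not> p dvd p * x - 1" for x
    using p1 by (metis dvd_diff_right_iff dvd_triv_right dvd_diff_left_iff dvd_triv_left dvd_diff_commute)+
  have 2: "p dvd x - y \<longleftrightarrow> y mod p = x mod p" for x y
    by (metis mod_eq_dvd_iff)
  show ?thesis
    using v w p1 ne 1 by (auto simp: reps_def det2_def residue_class_def 2 mult.left_commute[of _ p])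
qed

lemma cyclat_eq_if_class_eq:
  assumes p: "prime p" and v: "v \<in> reps p i" and w: "w \<in> reps p j"
    and eq: "residue_class p v = residue_class p w"
  shows "cyclat p v = cyclat p w"
proof (rule cyclat_cong)
  have p1: "\<not> p dvd 1" using p not_prime_unit by blast
  have pos: "p > 0" using p prime_gt_0_int by blast
  then have ne: "x mod p \<noteq> p" "p \<noteq> x mod p" for x by (metis pos_mod_bound less_irrefl)+
  show "p dvd fst v - fst w" "p dvd snd v - snd w"
    using v w eq p1 ne by (auto simp: reps_def residue_class_def mod_eq_dvd_iff)
qed

lemma cyclat_ne_UNIV:
  assumes p: "prime p" and v: "v \<in> reps p i"
  shows "cyclat p v \<noteq> UNIV"
proof -
  have p1: "\<not> p dvd 1" using p not_prime_unit by blast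
  then have "(0, 1) \<notin> cyclat p v \<or> (1, 0) \<notin> cyclat p v"
    using v by (auto simp: cyclat_def det2_def reps_def)
  then show ?thesis by blast
qed

text \<open>Since v lies in its own sublattice, p^i divides \<open>det2 w v\<close>. Modulo p this
  puts v and w in the same family of \<open>reps\<close>, where the determinant is a difference of
  parameters, up to a factor p in the second family, too small to be a nonzero multiple.\<close>

lemma cyclat_inj:
  assumes p: "prime p" and v: "v \<in> reps p i" and w: "w \<in> reps p i" and i: "1 \<le> i"
    and eq: "cyclat (p ^ i) v = cyclat (p ^ i) w"
  shows "v = w"
proof -
  have pos: "p > 0" using p prime_gt_0_int by blast
  have pi: "p ^ i = p * p ^ (i - 1)" using i by (metis power_eq_if not_one_le_zero)
  have dvd: "p ^ i dvd det2 w v"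
    using mem_cyclat_self[of 1 v "p ^ i"] unfolding eq by (simp add: cyclat_def smul_def)
  have small: "x = y" if "q dvd x - y" "0 \<le> x" "0 \<le> y" "x < q" "y < q" for x y q :: int
    using that by (metis mod_eq_dvd_iff mod_pos_pos_trivial)
  have "p dvd det2 w v" using dvd pi by (metis dvd_mult_left)
  then have "residue_class p v = residue_class p w"
    using prime_dvd_det2_iff[OF p w v] by simp
  then have fst: "p dvd fst v \<longleftrightarrow> p dvd fst w"
    using pos by (auto simp: residue_class_def split: if_splits dest: pos_mod_bound)
      (metis less_irrefl pos_mod_bound)+
  have p1: "\<not> p dvd 1" using p not_prime_unit by blast
  show ?thesis
  proof (cases "p dvd fst v")
    case True
    then obtain s s' where ss: "v = (p * s, 1)" "w = (p * s', 1)"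
      and b: "0 \<le> s" "s < p ^ (i - 1)" "0 \<le> s'" "s' < p ^ (i - 1)"
      using v w fst p1 pos that by (auto simp: reps_def)
    \<comment> \<open>The determinant of two vectors of the second family carries a factor p.
      Cancelling it leaves the modulus p^(i-1), which is exactly the range of s and s'.\<close>
    have "p * p ^ (i - 1) dvd p * (s' - s)"
      using dvd unfolding ss pi by (simp add: det2_def right_diff_distrib)
    then have "p ^ (i - 1) dvd s' - s" using pos by simp
    then show ?thesis using small b ss by metis
  next
    case False
    then obtain t t' where tt: "v = (1, t)" "w = (1, t')"
      and b: "0 \<le> t" "t < p ^ i" "0 \<le> t'" "t' < p ^ i"
      using v w fst by (auto simp: reps_def)
    have "p ^ i dvd t - t'" using dvd unfolding tt by (simp add: det2_def)
    then show ?thesis using small b tt by metis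
  qed
qed

section \<open>Hermite normal form and change of coordinates\<close>

definition hnf :: "int \<Rightarrow> int \<Rightarrow> int \<Rightarrow> int \<times> int \<Rightarrow> int \<times> int" where
  "hnf a d s z = (a * fst z, s * fst z + d * snd z)"

lemma hnf_inj: "\<lbrakk>a \<noteq> 0; d \<noteq> 0\<rbrakk> \<Longrightarrow> inj (hnf a d s)"
  by (auto simp: inj_def hnf_def)

lemma hnf_diff: "hnf a d s (x - y) = hnf a d s x - hnf a d s y"
  and hnf_plus: "hnf a d s (x + y) = hnf a d s x + hnf a d s y"
  and hnf_smul: "hnf a d s (smul k x) = smul k (hnf a d s x)"
  and hnf_zero: "hnf a d s 0 = 0"
  by (simp_all add: hnf_def prod_eq_iff algebra_simps)

lemma lat_hnf_image: "lat A \<Longrightarrow> lat (hnf a d s ` A)"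
  unfolding lat_def by (auto simp flip: hnf_diff simp: image_iff) (metis hnf_zero)

lemma lat_hnf_vimage: "lat A \<Longrightarrow> lat (hnf a d s -` A)"
  by (simp add: lat_def hnf_diff hnf_zero)

text \<open>The projection of \<open>L\<close> to the first axis is generated by p^u and its
  vertical part by p^v. A lift (p^u, s') together with (0, p^v) is then a basis, and s' may be
  reduced modulo p^v. The normal form is a map and not a set because it also serves as the
  coordinate change from the plane to \<open>L\<close>.\<close>

lemma lat_eq_range_hnf:
  assumes p: "prime p" and L: "lat L" "(p ^ a, 0) \<in> L" "(0, p ^ b) \<in> L"
  obtains u v s where "0 \<le> s" "s < p ^ v" "L = range (hnf (p ^ u) (p ^ v) s)"
proof -
  have pos: "p > 0" using p prime_gt_0_int by blast
  obtain u where u: "fst ` L = {m. p ^ u dvd m}"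
  proof (rule int_subgroup_prime_power[OF p, of "fst ` L" a])
    show "0 \<in> fst ` L" using lat_zero[OF L(1)] by force
    show "x - y \<in> fst ` L" if "x \<in> fst ` L" "y \<in> fst ` L" for x y
    proof -
      obtain z w where "z \<in> L" "w \<in> L" "x = fst z" "y = fst w" using \<open>x \<in> fst ` L\<close> \<open>y \<in> fst ` L\<close> by blast
      then show ?thesis using lat_diff[OF L(1), of z w] by (metis fst_diff image_eqI)
    qed
    show "p ^ a \<in> fst ` L" using L(2) by force
  qed
  define S where "S = {m. (0, m) \<in> L}"
  obtain v where v: "S = {m. p ^ v dvd m}"
  proof (rule int_subgroup_prime_power[OF p, of S b])
    show "0 \<in> S" using lat_zero[OF L(1)] by (simp add: S_def zero_prod_def)
    show "x - y \<in> S" if "x \<in> S" "y \<in> S" for x y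
      using lat_diff[OF L(1), of "(0, x)" "(0, y)"] that by (simp add: S_def minus_prod_def)
    show "p ^ b \<in> S" using L(3) by (simp add: S_def)
  qed
  have "p ^ u \<in> fst ` L" using u by simp
  then obtain s' where s': "(p ^ u, s') \<in> L" by (metis (no_types, opaque_lifting) imageE prod.collapse)
  define s where "s = s' mod p ^ v"
  have vert: "(0, m) \<in> L \<longleftrightarrow> p ^ v dvd m" for m using v by (auto simp: S_def)
  have "(0, s' - s) \<in> L" unfolding vert s_def by (simp add: minus_mod_eq_mult_div)
  from lat_diff[OF L(1) s' this] have s: "(p ^ u, s) \<in> L" by (simp add: minus_prod_def)
  have "z \<in> L \<longleftrightarrow> z \<in> range (hnf (p ^ u) (p ^ v) s)" for z
  proof
    assume z: "z \<in> L"
    then have "p ^ u dvd fst z" using u by blast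
    then obtain x where x: "fst z = p ^ u * x" by blast
    have "z - smul x (p ^ u, s) = (0, snd z - s * x)"
      using x by (simp add: prod_eq_iff mult.commute)
    then have "p ^ v dvd snd z - s * x"
      using lat_diff[OF L(1) z lat_smul[OF L(1) s, of x]] vert by simp
    then obtain y where "snd z - s * x = p ^ v * y" by blast
    then have "z = hnf (p ^ u) (p ^ v) s (x, y)" using x by (simp add: hnf_def prod_eq_iff)
    then show "z \<in> range (hnf (p ^ u) (p ^ v) s)" by blast
  next
    assume "z \<in> range (hnf (p ^ u) (p ^ v) s)"
    then obtain w where w: "z = hnf (p ^ u) (p ^ v) s w" by blast
    have "z = smul (fst w) (p ^ u, s) + (0, p ^ v * snd w)"
      by (simp add: w hnf_def prod_eq_iff)
    moreover have "(0, p ^ v * snd w) \<in> L" by (simp add: vert)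
    ultimately show "z \<in> L" using lat_add[OF L(1) lat_smul[OF L(1) s]] by metis
  qed
  then have "L = range (hnf (p ^ u) (p ^ v) s)" by blast
  then show thesis using that[of s v u] pos by (simp add: s_def)
qed

text \<open>The basis (p^u, s), (0, p^v) is triangular: the first coordinate forces the coefficient
  of (p^u, s), namely p^(a-u) or 0, and the second coordinate leaves a divisibility by p^v.\<close>

lemma mem_range_hnf:
  assumes p: "prime p"
  shows "(p ^ a, 0) \<in> range (hnf (p ^ u) (p ^ v) s) \<longleftrightarrow> u \<le> a \<and> p ^ v dvd p ^ (a - u) * s"
    and "(0, p ^ b) \<in> range (hnf (p ^ u) (p ^ v) s) \<longleftrightarrow> v \<le> b"
proof -
  have pos: "p > 0" using p prime_gt_0_int by blast
  have dvd: "p ^ x dvd p ^ y \<longleftrightarrow> x \<le> y" for x y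
    using p not_prime_unit by (subst dvd_power_iff) (auto simp: pos)
  show "(p ^ a, 0) \<in> range (hnf (p ^ u) (p ^ v) s) \<longleftrightarrow> u \<le> a \<and> p ^ v dvd p ^ (a - u) * s" (is "?l \<longleftrightarrow> ?r")
  proof
    assume ?l
    then obtain x y where "(p ^ a, 0) = hnf (p ^ u) (p ^ v) s (x, y)" by (metis rangeE surj_pair)
    then have xy: "p ^ a = p ^ u * x" "s * x + p ^ v * y = 0" by (simp_all add: hnf_def)
    then have "u \<le> a" using dvd by (metis dvd_triv_left)
    then have "p ^ a = p ^ u * p ^ (a - u)" by (simp flip: power_add)
    then have "x = p ^ (a - u)" using xy pos by simp
    then have "p ^ (a - u) * s = p ^ v * (- y)" using xy by (simp add: algebra_simps)
    then show ?r using \<open>u \<le> a\<close> by simp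
  next
    assume r: ?r
    then obtain y where y: "p ^ (a - u) * s = p ^ v * y" by blast
    have "p ^ a = p ^ u * p ^ (a - u)" using r by (simp flip: power_add)
    then have "(p ^ a, 0) = hnf (p ^ u) (p ^ v) s (p ^ (a - u), - y)"
      using y by (simp add: hnf_def mult.commute)
    then show ?l by blast
  qed
  show "(0, p ^ b) \<in> range (hnf (p ^ u) (p ^ v) s) \<longleftrightarrow> v \<le> b" (is "?l \<longleftrightarrow> ?r")
  proof
    assume ?l
    then show ?r using dvd pos by (auto simp: hnf_def) (metis dvd_triv_left)
  next
    assume ?r
    then have "(0, p ^ b) = hnf (p ^ u) (p ^ v) s (0, p ^ (b - v))"
      by (simp add: hnf_def flip: power_add)
    then show ?l by blast
  qed
qed

text \<open>v is determined by the powers of p on the vertical axis and u by mutual divisibility of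
  first coordinates; then s and s' differ by a multiple of p^v and both lie below it.\<close>

lemma range_hnf_inj:
  assumes p: "prime p" and s: "0 \<le> s" "s < p ^ v" "0 \<le> s'" "s' < p ^ v'"
    and eq: "range (hnf (p ^ u) (p ^ v) s) = range (hnf (p ^ u') (p ^ v') s')"
  shows "u = u'" "v = v'" "s = s'"
proof -
  have pos: "p > 0" using p prime_gt_0_int by blast
  have dvd: "p ^ x dvd p ^ y \<longleftrightarrow> x \<le> y" for x y
    using p not_prime_unit by (subst dvd_power_iff) (auto simp: pos)
  show v: "v = v'"
    using mem_range_hnf(2)[OF p] eq by (metis le_refl order_antisym)
  have "hnf (p ^ u) (p ^ v) s (1, 0) \<in> range (hnf (p ^ u') (p ^ v') s')" using eq by blast
  then obtain x y where xy: "p ^ u = p ^ u' * x" "s = s' * x + p ^ v' * y" by (auto simp: hnf_def)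
  have "hnf (p ^ u') (p ^ v') s' (1, 0) \<in> range (hnf (p ^ u) (p ^ v) s)" using eq by blast
  then obtain x' y' where xy': "p ^ u' = p ^ u * x'" by (auto simp: hnf_def)
  show u: "u = u'" using xy xy' dvd by (metis dvd_triv_left order_antisym)
  then have "x = 1" using xy pos by simp
  then have "p ^ v dvd s - s'" using xy v by simp
  then show "s = s'" using s v by (metis mod_eq_dvd_iff mod_pos_pos_trivial)
qed

text \<open>Provides the hypothesis, shared by \<open>nakayama_lat\<close> and
  \<open>lat_eq_cyclat\<close>, that a power of p times the plane is contained; the larger exponent
  serves for both axes.\<close>

lemma smul_mem_if_axis_multiples:
  assumes L: "lat L" "(p ^ a, 0) \<in> L" "(0, p ^ b) \<in> L" and "a \<le> b"
  shows "smul (p ^ b) z \<in> L"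
proof -
  have "p ^ b = p ^ (b - a) * p ^ a" using assms by (simp flip: power_add)
  then have "smul (p ^ b) z = smul (fst z * p ^ (b - a)) (p ^ a, 0) + smul (snd z) (0, p ^ b)"
    by (simp add: prod_eq_iff mult.commute)
  then show ?thesis using L lat_add lat_smul by metis
qed

lemma hnf_image_plus: "hnf a d s ` X + hnf a d s ` Y = hnf a d s ` (X + Y)"
proof (intro subset_antisym subsetI)
  fix z assume "z \<in> hnf a d s ` X + hnf a d s ` Y"
  then obtain x y where "x \<in> X" "y \<in> Y" "z = hnf a d s x + hnf a d s y"
    by (auto elim: set_plus_elim)
  then show "z \<in> hnf a d s ` (X + Y)" using set_plus_intro by (metis hnf_plus image_eqI)
next
  fix z assume "z \<in> hnf a d s ` (X + Y)"
  then obtain x y where "x \<in> X" "y \<in> Y" "z = hnf a d s (x + y)"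
    by (auto elim: set_plus_elim)
  then show "z \<in> hnf a d s ` X + hnf a d s ` Y" by (auto simp: hnf_plus intro!: set_plus_intro)
qed

section \<open>Diamonds whose join is the whole plane\<close>

definition diamond_triple :: "(int \<times> int) set \<Rightarrow> (int \<times> int) set \<Rightarrow> (int \<times> int) set \<Rightarrow> bool" where
  "diamond_triple A B C \<longleftrightarrow> lat A \<and> lat B \<and> lat C \<and> A \<noteq> B \<and> B \<noteq> C \<and> A \<noteq> C \<and>
     A \<inter> B = B \<inter> C \<and> A \<inter> C = B \<inter> C \<and> A + B = B + C \<and> A + C = B + C"

lemma diamond_triple_perm:
  "diamond_triple A B C \<Longrightarrow> diamond_triple B A C"
  "diamond_triple A B C \<Longrightarrow> diamond_triple A C B"
  by (auto simp: diamond_triple_def Int_commute add.commute)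

lemma diamond_triple_cyclat1:
  assumes p: "prime p" and t: "diamond_triple A B C" and n: "\<And>z. smul (p ^ n) z \<in> A"
    "\<And>z. smul (p ^ n) z \<in> B" and sum: "A + B = UNIV"
  obtains i a where "1 \<le> i" "a \<in> reps p i" "A = cyclat (p ^ i) a"
proof (rule lat_eq_cyclat[OF p _ n(1)])
  \<comment> \<open>If X were the plane, its meets with Y and Z would be Y and Z themselves, and
    equal meets would give Y = Z.\<close>
  have ntriv: "X \<noteq> UNIV" if "diamond_triple X Y Z" for X Y Z
    using that unfolding diamond_triple_def by (metis Int_UNIV_left)
  show "lat A" using t by (simp add: diamond_triple_def)
  show "A \<noteq> UNIV" using ntriv t by blast
  show "\<not> A \<subseteq> range (smul p)"
  proof
    assume "A \<subseteq> range (smul p)"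
    then have "B + range (smul p) = UNIV"
      using sum by (metis add.commute set_plus_mono2 order_refl top.extremum_uniqueI)
    then have "B = UNIV" using nakayama_lat n(2) t by (metis diamond_triple_def)
    then show False using ntriv diamond_triple_perm(1)[OF t] by blast
  qed
qed (use that in blast)

lemma diamond_triple_cyclat:
  assumes p: "prime p" and t: "diamond_triple A B C"
    and n: "\<And>z. smul (p ^ n) z \<in> A" "\<And>z. smul (p ^ n) z \<in> B" "\<And>z. smul (p ^ n) z \<in> C"
    and sum: "A + B = UNIV"
  obtains i a b c where "1 \<le> i" "a \<in> reps p i" "b \<in> reps p i" "c \<in> reps p i"
    "residue_class p a \<noteq> residue_class p b" "residue_class p b \<noteq> residue_class p c"
    "residue_class p a \<noteq> residue_class p c"
    "A = cyclat (p ^ i) a" "B = cyclat (p ^ i) b" "C = cyclat (p ^ i) c"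
proof -
  have pos: "p > 0" using p prime_gt_0_int by blast
  have sums: "A + C = UNIV" "B + C = UNIV" "B + A = UNIV" "C + A = UNIV"
    using sum t by (auto simp: diamond_triple_def add.commute)
  obtain i a where A: "1 \<le> i" "a \<in> reps p i" "A = cyclat (p ^ i) a"
    using diamond_triple_cyclat1[OF p t n(1,2) sum] by blast
  obtain j b where B: "1 \<le> j" "b \<in> reps p j" "B = cyclat (p ^ j) b"
    using diamond_triple_cyclat1[OF p diamond_triple_perm(1)[OF t] n(2,1) sums(3)] by blast
  obtain k c where C: "1 \<le> k" "c \<in> reps p k" "C = cyclat (p ^ k) c"
    using diamond_triple_cyclat1[OF p diamond_triple_perm(1)[OF diamond_triple_perm(2)[OF t]] n(3,1) sums(4)]
    by blast
  \<comment> \<open>Equal classes would put both summands into the same sublattice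
    \<open>cyclat p x\<close>, which is proper, so they could not span the plane.\<close>
  have ncl: "residue_class p x \<noteq> residue_class p y"
    if "1 \<le> i" "x \<in> reps p i" "1 \<le> j" "y \<in> reps p j" "cyclat (p ^ i) x + cyclat (p ^ j) y = UNIV"
    for x y i j
  proof
    assume eq: "residue_class p x = residue_class p y"
    have sub: "cyclat (p ^ k) z \<subseteq> cyclat p z" if "1 \<le> k" for k z
      using that by (auto simp: cyclat_def)
    have "cyclat (p ^ j) y \<subseteq> cyclat p x"
      using sub[OF that(3)] cyclat_eq_if_class_eq[OF p that(2,4) eq] by simp
    have "cyclat (p ^ i) x + cyclat (p ^ j) y \<subseteq> cyclat p x"
    proof (intro subsetI)
      fix z assume "z \<in> cyclat (p ^ i) x + cyclat (p ^ j) y"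
      then obtain v w where "v \<in> cyclat (p ^ i) x" "w \<in> cyclat (p ^ j) y" "z = v + w"
        by (rule set_plus_elim)
      with \<open>cyclat (p ^ j) y \<subseteq> cyclat p x\<close> sub[OF that(1), of x] show "z \<in> cyclat p x"
        using lat_add[OF lat_cyclat] by blast
    qed
    then show False using cyclat_ne_UNIV[OF p that(2)] that(5) by auto
  qed
  have cl: "residue_class p a \<noteq> residue_class p b" "residue_class p b \<noteq> residue_class p c"
    "residue_class p a \<noteq> residue_class p c"
    using ncl A B C sum sums by metis+
  \<comment> \<open>The test vector is p^j x: it lies in the first sublattice as a multiple of x and
    in the second as a multiple of p^j. Its membership in the third says that p^k divides p^j times
    a unit modulo p. Permuting the roles makes all three exponents equal.\<close>
  have le: "k \<le> j"
    if "x \<in> reps p i" "z \<in> reps p k" "residue_class p z \<noteq> residue_class p x"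
      "cyclat (p ^ i) x \<inter> cyclat (p ^ j) y \<subseteq> cyclat (p ^ k) z" for x y z i j k
  proof -
    have "smul (p ^ j) x \<in> cyclat (p ^ k) z"
      using that(4) mem_cyclat_self smul_mem_cyclat by blast
    then have "p ^ k dvd p ^ j * det2 z x"
      by (simp add: cyclat_def det2_def algebra_simps)
    moreover have "coprime (p ^ k) (det2 z x)"
      using prime_dvd_det2_iff[OF p that(2,1)] that(3) p by (simp add: prime_imp_coprime)
    ultimately have "p ^ k dvd p ^ j" using coprime_dvd_mult_left_iff by blast
    then show "k \<le> j" using p not_prime_unit pos by (subst (asm) dvd_power_iff) auto
  qed
  have int: "A \<inter> B \<subseteq> C" "B \<inter> A \<subseteq> C" "A \<inter> C \<subseteq> B" "C \<inter> A \<subseteq> B" "B \<inter> C \<subseteq> A" "C \<inter> B \<subseteq> A"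
    using t unfolding diamond_triple_def by blast+
  have "k \<le> j" using le[OF A(2) C(2)] cl int(1) unfolding A(3) B(3) C(3) by metis
  moreover have "j \<le> k" using le[OF A(2) B(2)] cl int(3) unfolding A(3) B(3) C(3) by metis
  moreover have "k \<le> i" using le[OF B(2) C(2)] cl int(2) unfolding A(3) B(3) C(3) by metis
  moreover have "i \<le> k" using le[OF B(2) A(2)] cl int(5) unfolding A(3) B(3) C(3) by metis
  ultimately have "j = i" "k = i" by auto
  then show thesis using that A B C cl by blast
qed

lemma coprime_det2_reps:
  assumes "prime p" "a \<in> reps p i" "b \<in> reps p i" "residue_class p a \<noteq> residue_class p b"
  shows "coprime (p ^ i) (det2 a b)"
  using assms prime_dvd_det2_iff[OF assms(1-3)] by (simp add: prime_imp_coprime)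

text \<open>The values of meet and sum in \<open>cyclat_Int\<close> and \<open>cyclat_plus\<close>
  do not depend on the two points, so points that are pairwise distinct modulo p share them.\<close>

lemma diamond_triple_cyclat_if:
  assumes p: "prime p" and i: "1 \<le> i" and r: "a \<in> reps p i" "b \<in> reps p i" "c \<in> reps p i"
    and cl: "residue_class p a \<noteq> residue_class p b" "residue_class p b \<noteq> residue_class p c"
    "residue_class p a \<noteq> residue_class p c"
  shows "diamond_triple (cyclat (p ^ i) a) (cyclat (p ^ i) b) (cyclat (p ^ i) c)"
    and "cyclat (p ^ i) a \<inter> cyclat (p ^ i) b = range (smul (p ^ i))"
    and "cyclat (p ^ i) a + cyclat (p ^ i) b = UNIV"
proof -
  note d = coprime_det2_reps[OF p]
  show "cyclat (p ^ i) a \<inter> cyclat (p ^ i) b = range (smul (p ^ i))"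
    and "cyclat (p ^ i) a + cyclat (p ^ i) b = UNIV"
    using cyclat_Int[OF d] cyclat_plus[OF d] r cl by blast+
  have "cyclat (p ^ i) x \<noteq> cyclat (p ^ i) y" if "x \<in> reps p i" "y \<in> reps p i"
    "residue_class p x \<noteq> residue_class p y" for x y
    using cyclat_inj[OF p that(1,2) i] that(3) by blast
  then show "diamond_triple (cyclat (p ^ i) a) (cyclat (p ^ i) b) (cyclat (p ^ i) c)"
    unfolding diamond_triple_def
    using cyclat_Int[OF d] cyclat_plus[OF d] r cl by (simp add: lat_cyclat)
qed

lemma diamond_triple_hnf_image:
  assumes ad: "a \<noteq> 0" "d \<noteq> 0"
  shows "diamond_triple (hnf a d s ` A) (hnf a d s ` B) (hnf a d s ` C) \<longleftrightarrow> diamond_triple A B C"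
proof -
  note inj = hnf_inj[OF ad, of s]
  have lat: "lat (hnf a d s ` X) \<longleftrightarrow> lat X" for X
    using lat_hnf_image lat_hnf_vimage inj_vimage_image_eq[OF inj] by metis
  show ?thesis
    unfolding diamond_triple_def lat hnf_image_plus
    by (simp add: inj_image_eq_iff[OF inj] flip: image_Int[OF inj])
qed

subsection \<open>Parametrizing the diamonds\<close>

text \<open>The two membership conditions say that the kernel of the projection to the finite group
  lies in the meet, hence in all five members.\<close>

definition lattice_diamonds :: "int \<Rightarrow> nat \<Rightarrow> nat \<Rightarrow> (int \<times> int) set set set" where
  "lattice_diamonds p \<alpha>1 \<alpha>2 =
    {D. \<exists>A B C. diamond_triple A B C \<and> (p ^ \<alpha>1, 0) \<in> A \<inter> B \<and> (0, p ^ \<alpha>2) \<in> A \<inter> B \<and>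
       D = {A \<inter> B, A, B, C, A + B}}"

lemma lattice_diamondsI:
  assumes "diamond_triple A B C" "(p ^ \<alpha>1, 0) \<in> A \<inter> B" "(0, p ^ \<alpha>2) \<in> A \<inter> B"
  shows "{A \<inter> B, A, B, C, A + B} \<in> lattice_diamonds p \<alpha>1 \<alpha>2"
  using assms unfolding lattice_diamonds_def by blast

text \<open>By \<open>mem_range_hnf\<close>, these are the normal forms of the sublattices that
  contain \<open>(p ^ a, 0)\<close> and \<open>(0, p ^ b)\<close>.\<close>

definition hnf_params :: "int \<Rightarrow> nat \<Rightarrow> nat \<Rightarrow> (nat \<times> nat \<times> int) set" where
  "hnf_params p a b =
    {(u, v, s). u \<le> a \<and> v \<le> b \<and> 0 \<le> s \<and> s < p ^ v \<and> p ^ v dvd p ^ (a - u) * s}"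

text \<open>Sets instead of ordered triples, since a diamond does not order its atoms; injectivity
  of the class makes all pairwise determinants units modulo p.\<close>

definition rep_triples :: "int \<Rightarrow> nat \<Rightarrow> (int \<times> int) set set" where
  "rep_triples p i = {T. T \<subseteq> reps p i \<and> card T = 3 \<and> inj_on (residue_class p) T}"

definition std_diamond :: "int \<Rightarrow> nat \<Rightarrow> (int \<times> int) set \<Rightarrow> (int \<times> int) set set" where
  "std_diamond p i T = insert (range (smul (p ^ i))) (insert UNIV (cyclat (p ^ i) ` T))"

definition diamond_of :: "int \<Rightarrow> nat \<times> (nat \<times> nat \<times> int) \<times> (int \<times> int) set \<Rightarrow> (int \<times> int) set set" where
  "diamond_of p = (\<lambda>(i, (u, v, s), T). (`) (hnf (p ^ u) (p ^ v) s) ` std_diamond p i T)"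

lemma diamond_of_in_lattice_diamonds:
  assumes p: "prime p" and i: "1 \<le> i" "i \<le> \<alpha>1" "\<alpha>1 \<le> \<alpha>2"
    and x: "x \<in> hnf_params p (\<alpha>1 - i) (\<alpha>2 - i)" and T: "T \<in> rep_triples p i"
  shows "diamond_of p (i, x, T) \<in> lattice_diamonds p \<alpha>1 \<alpha>2"
proof -
  have pos: "p > 0" using p prime_gt_0_int by blast
  obtain u v s where x': "x = (u, v, s)" using prod_cases3 by blast
  define M where "M = hnf (p ^ u) (p ^ v) s"
  obtain a b c where abc: "T = {a, b, c}" "a \<noteq> b" "a \<noteq> c" "b \<noteq> c"
    using T by (auto simp: rep_triples_def card_3_iff)
  have r: "a \<in> reps p i" "b \<in> reps p i" "c \<in> reps p i"
    and cl: "residue_class p a \<noteq> residue_class p b" "residue_class p b \<noteq> residue_class p c"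
    "residue_class p a \<noteq> residue_class p c"
    using T abc by (auto simp: rep_triples_def inj_on_def)
  note D = diamond_triple_cyclat_if[OF p i(1) r cl]
  have inj: "inj M" using pos by (simp add: M_def hnf_inj)
  have "diamond_triple (M ` cyclat (p ^ i) a) (M ` cyclat (p ^ i) b) (M ` cyclat (p ^ i) c)"
    unfolding M_def using D(1) pos by (simp add: diamond_triple_hnf_image)
  moreover have ints: "M ` cyclat (p ^ i) a \<inter> M ` cyclat (p ^ i) b = M ` range (smul (p ^ i))"
    using D(2) image_Int[OF inj] by metis
  moreover have sum: "M ` cyclat (p ^ i) a + M ` cyclat (p ^ i) b = range M"
    using D(3) by (simp add: M_def hnf_image_plus)
  \<comment> \<open>The meet is p^i times the range of \<open>M\<close>. The parameters provide the
    axis vectors with exponents lowered by i in that range, and multiplying them by p^i restores the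
    exponents.\<close>
  moreover have "(p ^ \<alpha>1, 0) \<in> M ` range (smul (p ^ i)) \<and> (0, p ^ \<alpha>2) \<in> M ` range (smul (p ^ i))"
  proof -
    have "(p ^ (\<alpha>1 - i), 0) \<in> range M" "(0, p ^ (\<alpha>2 - i)) \<in> range M"
      using x unfolding x' M_def mem_range_hnf[OF p] by (auto simp: hnf_params_def)
    then obtain z w where zw: "(p ^ (\<alpha>1 - i), 0) = M z" "(0, p ^ (\<alpha>2 - i)) = M w" by blast
    have "(p ^ \<alpha>1, 0) = smul (p ^ i) (M z)" "(0, p ^ \<alpha>2) = smul (p ^ i) (M w)"
      using i unfolding zw[symmetric] by (simp_all add: smul_def flip: power_add)
    then have "(p ^ \<alpha>1, 0) = M (smul (p ^ i) z)" "(0, p ^ \<alpha>2) = M (smul (p ^ i) w)"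
      by (simp_all add: M_def hnf_smul)
    then show ?thesis by blast
  qed
  moreover have "diamond_of p (i, x, T) = {M ` range (smul (p ^ i)), M ` cyclat (p ^ i) a,
      M ` cyclat (p ^ i) b, M ` cyclat (p ^ i) c, range M}"
    by (auto simp: diamond_of_def x' M_def std_diamond_def abc)
  ultimately show ?thesis
    using lattice_diamondsI[of "M ` cyclat (p ^ i) a" "M ` cyclat (p ^ i) b" "M ` cyclat (p ^ i) c" p \<alpha>1 \<alpha>2]
    by (simp only: ints sum)
qed

text \<open>\<open>M\<close> is injective with range \<open>A + B\<close>, and all three subgroups
  lie in that range, so pulling back along \<open>M\<close> loses nothing and makes the join the
  whole plane.\<close>

lemma lattice_diamonds_surj:
  assumes p: "prime p" and \<alpha>: "\<alpha>1 \<le> \<alpha>2" and D: "D \<in> lattice_diamonds p \<alpha>1 \<alpha>2"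
  obtains i x T where "1 \<le> i" "i \<le> \<alpha>1" "x \<in> hnf_params p (\<alpha>1 - i) (\<alpha>2 - i)"
    "T \<in> rep_triples p i" "D = diamond_of p (i, x, T)"
proof -
  have pos: "p > 0" using p prime_gt_0_int by blast
  obtain A B C where t: "diamond_triple A B C" and N: "(p ^ \<alpha>1, 0) \<in> A \<inter> B" "(0, p ^ \<alpha>2) \<in> A \<inter> B"
    and D: "D = {A \<inter> B, A, B, C, A + B}"
    using D unfolding lattice_diamonds_def by blast
  have lat: "lat A" "lat B" "lat C" using t by (auto simp: diamond_triple_def)
  have NC: "(p ^ \<alpha>1, 0) \<in> C" "(0, p ^ \<alpha>2) \<in> C" using N t unfolding diamond_triple_def by blast+
  have sub: "A \<subseteq> A + B" "B \<subseteq> A + B" "C \<subseteq> A + B"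
    using lat_subset_plus lat t unfolding diamond_triple_def by metis+
  obtain u v s where s: "0 \<le> s" "s < p ^ v" and J: "A + B = range (hnf (p ^ u) (p ^ v) s)"
    using lat_eq_range_hnf[OF p lat_plus[OF lat(1,2)] subsetD[OF sub(1) IntD1[OF N(1)]]
      subsetD[OF sub(1) IntD1[OF N(2)]]] by metis
  define M where "M = hnf (p ^ u) (p ^ v) s"
  have inj: "inj M" using pos by (simp add: M_def hnf_inj)
  have J: "A + B = range M" using J by (simp add: M_def)
  have im: "M ` (M -` X) = X" if "X \<subseteq> A + B" for X
    using that unfolding J by (simp add: image_vimage_eq Int_absorb2)
  note imABC = im[OF sub(1)] im[OF sub(2)] im[OF sub(3)]
  have t': "diamond_triple (M -` A) (M -` B) (M -` C)"
    using t imABC diamond_triple_hnf_image[of "p ^ u" "p ^ v" s "M -` A" "M -` B" "M -` C"] pos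
    by (simp add: M_def)
  have "M ` (M -` A + M -` B) = M ` UNIV"
    using imABC J hnf_image_plus[of "p ^ u" "p ^ v" s "M -` A" "M -` B"] by (simp add: M_def)
  then have sum: "M -` A + M -` B = UNIV" by (simp only: inj_image_eq_iff[OF inj])
  have n: "smul (p ^ \<alpha>2) z \<in> M -` X" if "lat X" "(p ^ \<alpha>1, 0) \<in> X" "(0, p ^ \<alpha>2) \<in> X" for X z
    using smul_mem_if_axis_multiples[OF that \<alpha>] by (simp add: M_def hnf_smul)
  obtain i a b c where i: "1 \<le> i" and r: "a \<in> reps p i" "b \<in> reps p i" "c \<in> reps p i"
    and cl: "residue_class p a \<noteq> residue_class p b" "residue_class p b \<noteq> residue_class p c"
    "residue_class p a \<noteq> residue_class p c"
    and ABC: "M -` A = cyclat (p ^ i) a" "M -` B = cyclat (p ^ i) b" "M -` C = cyclat (p ^ i) c"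
    using diamond_triple_cyclat[OF p t' n n n sum] lat N NC by (metis IntD1 IntD2)
  note DT = diamond_triple_cyclat_if[OF p i r cl]
  have "M -` A \<inter> M -` B = range (smul (p ^ i))" using DT(2) ABC by simp
  then have int: "A \<inter> B = M ` range (smul (p ^ i))"
    using imABC image_Int[OF inj] by metis
  have 1: "\<exists>w. z = smul (p ^ i) (M w)" if "z \<in> A \<inter> B" for z
    using that unfolding int M_def hnf_smul[symmetric] by blast
  obtain z w where zw: "(p ^ \<alpha>1, 0) = smul (p ^ i) (M z)" "(0, p ^ \<alpha>2) = smul (p ^ i) (M w)"
    using 1 N by metis
  \<comment> \<open>The bound on i is forced by the meet: all its vectors are multiples of p^i, in
    particular the one on the first axis.\<close>
  have "p ^ i dvd p ^ \<alpha>1" using zw(1) by (metis dvd_triv_left fst_conv fst_smul)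
  then have i\<alpha>: "i \<le> \<alpha>1" using p not_prime_unit pos by (subst (asm) dvd_power_iff) auto
  have pw: "p ^ \<alpha>1 = p ^ i * p ^ (\<alpha>1 - i)" "p ^ \<alpha>2 = p ^ i * p ^ (\<alpha>2 - i)"
    using i\<alpha> \<alpha> by (simp_all flip: power_add)
  have "(p ^ (\<alpha>1 - i), 0) = M z" "(0, p ^ (\<alpha>2 - i)) = M w"
    using zw pos unfolding pw by (auto simp: prod_eq_iff)
  then have "(p ^ (\<alpha>1 - i), 0) \<in> range M" "(0, p ^ (\<alpha>2 - i)) \<in> range M" by auto
  then have x: "(u, v, s) \<in> hnf_params p (\<alpha>1 - i) (\<alpha>2 - i)"
    using s unfolding M_def mem_range_hnf[OF p] by (simp add: hnf_params_def)
  have T: "{a, b, c} \<in> rep_triples p i"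
  proof -
    have "a \<noteq> b" "a \<noteq> c" "b \<noteq> c" using cl by auto
    then show ?thesis using r cl by (auto simp: rep_triples_def inj_on_def)
  qed
  have "D = diamond_of p (i, (u, v, s), {a, b, c})"
  proof -
    have "diamond_of p (i, (u, v, s), {a, b, c}) = {M ` range (smul (p ^ i)), M ` UNIV,
        M ` cyclat (p ^ i) a, M ` cyclat (p ^ i) b, M ` cyclat (p ^ i) c}"
      by (simp add: diamond_of_def std_diamond_def flip: M_def)
    also have "\<dots> = {A \<inter> B, A + B, A, B, C}"
      by (simp only: int J imABC flip: ABC)
    also have "\<dots> = D" unfolding D by (simp only: insert_commute)
    finally show ?thesis by simp
  qed
  with that[OF i i\<alpha> x T] show thesis by blast
qed

lemma range_smul_inj:
  assumes "p > 1" "range (smul (p ^ i)) = range (smul (p ^ j))"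
  shows "i = j"
proof -
  have "p ^ y dvd p ^ x" if "range (smul (p ^ x)) \<subseteq> range (smul (p ^ y))" for x y
  proof -
    have "smul (p ^ x) (1, 0) \<in> range (smul (p ^ y))" using that by blast
    then show ?thesis by (auto simp: smul_def)
  qed
  then have "p ^ i dvd p ^ j" "p ^ j dvd p ^ i" using assms by auto
  then show ?thesis using assms by (auto simp: dvd_power_iff)
qed

lemma diamond_of_inj:
  assumes p: "prime p" and i: "1 \<le> i" "1 \<le> i'"
    and x: "x \<in> hnf_params p m n" "x' \<in> hnf_params p m' n'"
    and T: "T \<in> rep_triples p i" "T' \<in> rep_triples p i'"
    and eq: "diamond_of p (i, x, T) = diamond_of p (i', x', T')"
  shows "(i, x, T) = (i', x', T')"
proof -
  have pos: "p > 1" using p prime_gt_1_int by blast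
  obtain u v s u' v' s' where xs: "x = (u, v, s)" "x' = (u', v', s')" using prod_cases3 by metis
  \<comment> \<open>The union and the intersection of a diamond recover $J$ and $p^i J$.\<close>
  have un: "\<Union> (diamond_of p (i, (u, v, s), T)) = range (hnf (p ^ u) (p ^ v) s)" for i u v s T
    by (auto simp: diamond_of_def std_diamond_def)
  have int: "\<Inter> (diamond_of p (i, (u, v, s), T)) = hnf (p ^ u) (p ^ v) s ` range (smul (p ^ i))"
    for i u v s T
    using smul_mem_cyclat by (fastforce simp: diamond_of_def std_diamond_def)
  have "range (hnf (p ^ u) (p ^ v) s) = range (hnf (p ^ u') (p ^ v') s')"
    using un eq xs by metis
  then have x: "x = x'"
    using range_hnf_inj[OF p, of s v s' v' u u'] x xs by (simp add: hnf_params_def)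
  define M where "M = hnf (p ^ u) (p ^ v) s"
  have inj: "inj M" using pos by (simp add: M_def hnf_inj)
  have "M ` range (smul (p ^ i)) = M ` range (smul (p ^ i'))"
    using int eq x xs unfolding M_def by metis
  then have ii: "i = i'" using range_smul_inj[OF pos] by (simp only: inj_image_eq_iff[OF inj])
  have "std_diamond p i T = std_diamond p i T'"
  proof -
    have "inj ((`) M)" using inj inj_image_eq_iff by (metis injI)
    moreover have "(`) M ` std_diamond p i T = (`) M ` std_diamond p i T'"
      using eq x ii xs by (simp add: diamond_of_def M_def)
    ultimately show ?thesis by (simp only: inj_image_eq_iff)
  qed
  \<comment> \<open>The points are recovered as those whose sublattice occurs in the diamond. This
    requires that no such sublattice is the top or the bottom: it lies in a proper
    \<open>cyclat p w\<close>, and it contains w, which is not divisible by p.\<close>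
  moreover have "T = {w \<in> reps p i. cyclat (p ^ i) w \<in> std_diamond p i T}" if T: "T \<in> rep_triples p i" for T
  proof -
    have ne: "cyclat (p ^ i) w \<noteq> UNIV" "cyclat (p ^ i) w \<noteq> range (smul (p ^ i))" if w: "w \<in> reps p i" for w
    proof -
      have pi: "p dvd p ^ i" using i by (simp add: dvd_power)
      have "cyclat (p ^ i) w \<subseteq> cyclat p w" using pi dvd_trans by (auto simp: cyclat_def)
      then show "cyclat (p ^ i) w \<noteq> UNIV" using cyclat_ne_UNIV[OF p w] by auto
      have "w \<in> cyclat (p ^ i) w" by (simp add: cyclat_def det2_def)
      moreover have "w \<notin> range (smul (p ^ i))"
      proof
        assume "w \<in> range (smul (p ^ i))"
        then have "p dvd fst w" "p dvd snd w" using pi by auto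
        then show False using w p not_prime_unit by (auto simp: reps_def)
      qed
      ultimately show "cyclat (p ^ i) w \<noteq> range (smul (p ^ i))" by blast
    qed
    have sub: "T \<subseteq> reps p i" using T by (simp add: rep_triples_def)
    have mem: "w \<in> T" if w: "w \<in> reps p i" and "cyclat (p ^ i) w \<in> cyclat (p ^ i) ` T" for w
    proof -
      from that obtain v where "v \<in> T" "cyclat (p ^ i) w = cyclat (p ^ i) v" by blast
      then show ?thesis using cyclat_inj[OF p w subsetD[OF sub] i(1)] by metis
    qed
    show ?thesis
    proof (intro subset_antisym subsetI)
      show "w \<in> {w \<in> reps p i. cyclat (p ^ i) w \<in> std_diamond p i T}" if "w \<in> T" for w
        using subsetD[OF sub that] that by (simp add: std_diamond_def)
      show "w \<in> T" if "w \<in> {w \<in> reps p i. cyclat (p ^ i) w \<in> std_diamond p i T}" for w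
        using that ne[of w] mem[of w] by (simp add: std_diamond_def)
    qed
  qed
  ultimately have "T = T'" using T ii by metis
  then show ?thesis using x ii by simp
qed

lemma bij_betw_lattice_diamonds:
  assumes p: "prime p" and \<alpha>: "\<alpha>1 \<le> \<alpha>2"
  shows "bij_betw (diamond_of p)
    (SIGMA i:{1..\<alpha>1}. hnf_params p (\<alpha>1 - i) (\<alpha>2 - i) \<times> rep_triples p i)
    (lattice_diamonds p \<alpha>1 \<alpha>2)" (is "bij_betw _ ?S _")
  unfolding bij_betw_def
proof
  show "inj_on (diamond_of p) ?S"
  proof (rule inj_onI)
    fix X X' assume "X \<in> ?S" "X' \<in> ?S" and eq: "diamond_of p X = diamond_of p X'"
    moreover obtain i x T i' x' T' where X: "X = (i, x, T)" "X' = (i', x', T')"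
      using prod_cases3 by metis
    ultimately have "1 \<le> i" "1 \<le> i'"
      "x \<in> hnf_params p (\<alpha>1 - i) (\<alpha>2 - i)" "x' \<in> hnf_params p (\<alpha>1 - i') (\<alpha>2 - i')"
      "T \<in> rep_triples p i" "T' \<in> rep_triples p i'"
      by simp_all
    then show "X = X'" using diamond_of_inj[OF p] eq X by blast
  qed
  show "diamond_of p ` ?S = lattice_diamonds p \<alpha>1 \<alpha>2"
  proof (intro subset_antisym subsetI)
    show "D \<in> lattice_diamonds p \<alpha>1 \<alpha>2" if "D \<in> diamond_of p ` ?S" for D
      using that diamond_of_in_lattice_diamonds[OF p _ _ \<alpha>] by (elim imageE SigmaE) simp
    show "D \<in> diamond_of p ` ?S" if D: "D \<in> lattice_diamonds p \<alpha>1 \<alpha>2" for D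
    proof -
      obtain i x T where "1 \<le> i" "i \<le> \<alpha>1" "x \<in> hnf_params p (\<alpha>1 - i) (\<alpha>2 - i)"
        "T \<in> rep_triples p i" "D = diamond_of p (i, x, T)"
        using lattice_diamonds_surj[OF p \<alpha> D] by metis
      then show ?thesis by auto
    qed
  qed
qed

subsection \<open>Passage to the finite group\<close>

locale mod_pair =
  fixes q1 q2 :: nat
  assumes q1: "q1 > 0" and q2: "q2 > 0"
begin

abbreviation G :: "(int \<times> int) monoid" where
  "G \<equiv> integer_mod_group q1 \<times>\<times> integer_mod_group q2"

text \<open>The group consists of pairs of canonical residues, of the same type as the plane, so the
  projection is a map of the plane to itself that fixes the carrier pointwise.\<close>

definition red :: "int \<times> int \<Rightarrow> int \<times> int" where
  "red z = (fst z mod int q1, snd z mod int q2)"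

sublocale G: group G
  by (simp add: DirProd_group)

lemma red_carrier: "red z \<in> carrier G"
  using q1 q2 by (simp add: red_def carrier_integer_mod_group)

lemma red_id: "z \<in> carrier G \<Longrightarrow> red z = z"
  using q1 q2 by (auto simp: red_def carrier_integer_mod_group)

lemma red_zero: "red 0 = \<one>\<^bsub>G\<^esub>"
  by (simp add: red_def)

lemma red_plus: "red (x + y) = red x \<otimes>\<^bsub>G\<^esub> red y"
  by (simp add: red_def mult_DirProd' mod_add_eq)

lemma red_uminus: "red (- x) = inv\<^bsub>G\<^esub> red x"
proof -
  have "red (- x) \<otimes>\<^bsub>G\<^esub> red x = \<one>\<^bsub>G\<^esub>"
    unfolding red_plus[symmetric] red_zero[symmetric] by simp
  then show ?thesis using G.inv_equality red_carrier by metis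
qed

lemma red_diff: "red (x - y) = red x \<otimes>\<^bsub>G\<^esub> inv\<^bsub>G\<^esub> red y"
  using red_plus[of x "- y"] by (simp add: red_uminus)

lemma lat_vimage:
  assumes "subgroup H G"
  shows "lat (red -` H)"
  unfolding lat_def vimage_eq red_zero red_diff
  using subgroup.one_closed[OF assms] subgroup.m_closed[OF assms] subgroup.m_inv_closed[OF assms]
  by blast

lemma vimage_mem:
  assumes "subgroup H G"
  shows "(int q1, 0) \<in> red -` H" "(0, int q2) \<in> red -` H"
  using subgroup.one_closed[OF assms] by (simp_all add: red_def)

lemma image_vimage:
  assumes "subgroup H G"
  shows "red ` (red -` H) = H"
proof -
  have "z \<in> range red" if "z \<in> H" for z
    using red_id[of z] subgroup.mem_carrier[OF assms that] by (metis rangeI)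
  then show ?thesis unfolding image_vimage_eq by blast
qed

lemma subgroup_image:
  assumes "lat L"
  shows "subgroup (red ` L) G"
proof (rule G.subgroupI)
  show "red ` L \<subseteq> carrier G" using red_carrier by blast
  show "red ` L \<noteq> {}" using lat_zero[OF assms] by blast
  show "inv\<^bsub>G\<^esub> a \<in> red ` L" if "a \<in> red ` L" for a
    using that lat_uminus[OF assms] by (auto simp flip: red_uminus)
  show "a \<otimes>\<^bsub>G\<^esub> b \<in> red ` L" if ab: "a \<in> red ` L" "b \<in> red ` L" for a b
  proof -
    obtain x y where "x \<in> L" "y \<in> L" "a = red x" "b = red y" using ab by blast
    then show ?thesis using lat_add[OF assms] red_plus by (metis image_eqI)
  qed
qed

text \<open>Points with the same reduction differ by a combination of (q1, 0) and (0, q2), which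
  \<open>L\<close> contains. With \<open>image_vimage\<close> this is the correspondence theorem for
  subgroups of the quotient.\<close>

lemma vimage_image:
  assumes L: "lat L" "(int q1, 0) \<in> L" "(0, int q2) \<in> L"
  shows "red -` (red ` L) = L"
proof (intro subset_antisym subsetI)
  fix z assume "z \<in> red -` (red ` L)"
  then obtain w where w: "w \<in> L" "red z = red w" by blast
  then have "int q1 dvd fst z - fst w" "int q2 dvd snd z - snd w"
    by (auto simp: red_def mod_eq_dvd_iff)
  then obtain k l where "fst z - fst w = int q1 * k" "snd z - snd w = int q2 * l" by blast
  then have "z = w + (smul k (int q1, 0) + smul l (0, int q2))"
    by (simp add: prod_eq_iff algebra_simps)
  then show "z \<in> L" using w L lat_add lat_smul by metis
qed blast

text \<open>The image of the sum of the preimages is a subgroup containing \<open>A\<close> and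
  \<open>B\<close>, and its elements are products of one from each, so it is the generated subgroup.
  The sum contains the kernel and is therefore the full preimage.\<close>

lemma vimage_generate:
  assumes A: "subgroup A G" and B: "subgroup B G"
  shows "red -` generate G (A \<union> B) = red -` A + red -` B"
proof -
  let ?L = "red -` A + red -` B"
  have L: "lat ?L" by (simp add: lat_plus lat_vimage A B)
  have sub: "red -` A \<subseteq> ?L" "red -` B \<subseteq> ?L"
    using lat_subset_plus lat_vimage A B by blast+
  have "A \<union> B \<subseteq> red ` ?L"
    using image_mono[OF sub(1), of red] image_mono[OF sub(2), of red]
    unfolding image_vimage[OF A] image_vimage[OF B] by (rule Un_least)
  then have "generate G (A \<union> B) \<subseteq> red ` ?L"
    using G.generate_subgroup_incl subgroup_image[OF L] by blast
  moreover have "red ` ?L \<subseteq> generate G (A \<union> B)"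
  proof
    fix z assume "z \<in> red ` ?L"
    then obtain w where w: "w \<in> ?L" "z = red w" by blast
    from w(1) obtain x y where "x \<in> red -` A" "y \<in> red -` B" and xy: "w = x + y"
      by (rule set_plus_elim)
    then have "red x \<in> generate G (A \<union> B)" "red y \<in> generate G (A \<union> B)"
      by (simp_all add: generate.incl)
    then show "z \<in> generate G (A \<union> B)"
      unfolding w(2) xy red_plus by (rule generate.eng)
  qed
  ultimately have "generate G (A \<union> B) = red ` ?L" by blast
  moreover have "red -` (red ` ?L) = ?L"
    using vimage_image[OF L] vimage_mem[OF A] sub(1) by (metis subsetD)
  ultimately show ?thesis by simp
qed

lemma vimage_eq_iff:
  "\<lbrakk>subgroup A G; subgroup B G\<rbrakk> \<Longrightarrow> red -` A = red -` B \<longleftrightarrow> A = B"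
  using image_vimage by metis

lemma diamond_triple_vimage:
  assumes s: "subgroup A G" "subgroup B G" "subgroup C G"
  shows "diamond_triple (red -` A) (red -` B) (red -` C) \<longleftrightarrow>
    A \<noteq> B \<and> B \<noteq> C \<and> A \<noteq> C \<and> A \<inter> B = B \<inter> C \<and> A \<inter> C = B \<inter> C \<and>
    generate G (A \<union> B) = generate G (B \<union> C) \<and> generate G (A \<union> C) = generate G (B \<union> C)"
proof -
  have g: "subgroup (generate G (X \<union> Y)) G" if "subgroup X G" "subgroup Y G" for X Y
    using that subgroup.subset by (intro G.generate_is_subgroup) blast
  show ?thesis
    unfolding diamond_triple_def
    using s by (simp add: lat_vimage vimage_eq_iff g G.subgroups_Inter_pair
      flip: vimage_generate vimage_Int)
qed

lemma diamond_if_triple: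
  assumes "subgroup A G" "subgroup B G" "subgroup C G"
    and "diamond_triple (red -` A) (red -` B) (red -` C)"
  shows "diamond G {A \<inter> B, A, B, C, generate G (A \<union> B)}"
  using assms(1-3) assms(4)[unfolded diamond_triple_vimage[OF assms(1-3)]]
  unfolding G.diamond_iff by blast

text \<open>Taking preimages of all five members is a bijection, undone by taking images under
  \<open>red\<close>. The set on the right is \<open>lattice_diamonds\<close> with arbitrary moduli
  in place of powers of p.\<close>

lemma card_diamonds:
  "dm G = card {D. \<exists>A B C. diamond_triple A B C \<and> (int q1, 0) \<in> A \<inter> B \<and> (0, int q2) \<in> A \<inter> B \<and>
       D = {A \<inter> B, A, B, C, A + B}}" (is "_ = card ?R")
proof -
  have sub: "subgroup X G" if "diamond G D" "X \<in> D" for X D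
    using that by (auto simp: diamond_def sublattice_def)
  have "bij_betw ((`) ((-`) red)) {D. diamond G D} ?R"
    unfolding bij_betw_def
  proof
    have "D = (`) red ` (-`) red ` D" if "diamond G D" for D
      unfolding image_image using sub[OF that] image_vimage by simp
    then show "inj_on ((`) ((-`) red)) {D. diamond G D}"
      by (metis (mono_tags, lifting) inj_onI mem_Collect_eq)
    show "(`) ((-`) red) ` {D. diamond G D} = ?R"
    proof (intro subset_antisym subsetI)
      fix E assume "E \<in> (`) ((-`) red) ` {D. diamond G D}"
      then obtain D where "diamond G D" and E: "E = (-`) red ` D" by blast
      then obtain A B C where s: "subgroup A G" "subgroup B G" "subgroup C G"
        and t: "A \<noteq> B \<and> B \<noteq> C \<and> A \<noteq> C \<and> A \<inter> B = B \<inter> C \<and> A \<inter> C = B \<inter> C \<and>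
          generate G (A \<union> B) = generate G (B \<union> C) \<and> generate G (A \<union> C) = generate G (B \<union> C)"
        and D: "D = {A \<inter> B, A, B, C, generate G (A \<union> B)}"
        unfolding G.diamond_iff by blast
      have "diamond_triple (red -` A) (red -` B) (red -` C)"
        using diamond_triple_vimage[OF s] t by blast
      moreover have "E = {red -` A \<inter> red -` B, red -` A, red -` B, red -` C, red -` A + red -` B}"
        unfolding E D by (simp add: vimage_generate s vimage_Int)
      ultimately show "E \<in> ?R" using vimage_mem s by blast
    next
      fix E assume "E \<in> ?R"
      then obtain A B C where t: "diamond_triple A B C" and N: "(int q1, 0) \<in> A \<inter> B" "(0, int q2) \<in> A \<inter> B"
        and E: "E = {A \<inter> B, A, B, C, A + B}" by blast
      have lat: "lat A" "lat B" "lat C" using t by (auto simp: diamond_triple_def)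
      have NC: "(int q1, 0) \<in> C" "(0, int q2) \<in> C" using N t unfolding diamond_triple_def by blast+
      have s: "subgroup (red ` A) G" "subgroup (red ` B) G" "subgroup (red ` C) G"
        using lat subgroup_image by blast+
      have v: "red -` (red ` A) = A" "red -` (red ` B) = B" "red -` (red ` C) = C"
        using lat N NC vimage_image by blast+
      let ?D = "{red ` A \<inter> red ` B, red ` A, red ` B, red ` C, generate G (red ` A \<union> red ` B)}"
      have "diamond G ?D"
        using diamond_if_triple[OF s] t unfolding v by blast
      moreover have "E = (-`) red ` ?D"
        unfolding E by (simp add: vimage_generate s v vimage_Int)
      ultimately show "E \<in> (`) ((-`) red) ` {D. diamond G D}" by blast
    qed
  qed
  then show ?thesis unfolding dm_def by (rule bij_betw_same_card)
qed

end

subsection \<open>Counting\<close>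

text \<open>A set \<open>T\<close> on which f is injective amounts to its image U in
  \<open>Y\<close>, one of (card Y choose k), and a section over U, that is, one of m points in each
  of k fibres.\<close>

lemma card_partial_transversals:
  assumes X: "finite X" and Y: "finite Y" "f ` X \<subseteq> Y"
    and m: "\<And>y. y \<in> Y \<Longrightarrow> card {x \<in> X. f x = y} = m"
  shows "card {T. T \<subseteq> X \<and> card T = k \<and> inj_on f T} = (card Y choose k) * m ^ k"
proof -
  define F where "F = (\<lambda>y. {x \<in> X. f x = y})"
  define S where "S = (SIGMA U:{U. U \<subseteq> Y \<and> card U = k}. PiE U F)"
  have fU: "f ` g ` U = U" "inj_on g U" if "g \<in> PiE U F" for g U
  proof -
    have 1: "f (g y) = y" if "y \<in> U" for y
      using \<open>g \<in> PiE U F\<close> that by (auto simp: F_def PiE_iff)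
    then show "f ` g ` U = U" by (auto simp: image_iff)
    show "inj_on g U" using 1 by (metis inj_on_inverseI)
  qed
  have "bij_betw (\<lambda>(U, g). g ` U) S {T. T \<subseteq> X \<and> card T = k \<and> inj_on f T}"
    unfolding bij_betw_def
  proof
    show "inj_on (\<lambda>(U, g). g ` U) S"
    proof (rule inj_onI, clarify)
      fix U g U' g' assume "(U, g) \<in> S" "(U', g') \<in> S" and eq: "g ` U = g' ` U'"
      then have g: "g \<in> PiE U F" "g' \<in> PiE U' F" by (auto simp: S_def)
      have U: "U = U'" using fU(1) g eq by metis
      moreover have "g = g'"
      proof (rule PiE_ext[OF g(1)])
        show "g' \<in> PiE U F" using g U by simp
        fix y assume y: "y \<in> U"
        then obtain y' where y': "y' \<in> U" "g y = g' y'" using eq U by (metis image_eqI imageE)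
        have "f (g y) = y" "f (g' y') = y'" using g U y y' by (auto simp: F_def PiE_iff)
        then show "g y = g' y" using y' by simp
      qed
      ultimately show "U = U' \<and> g = g'" by simp
    qed
    show "(\<lambda>(U, g). g ` U) ` S = {T. T \<subseteq> X \<and> card T = k \<and> inj_on f T}"
    proof (intro subset_antisym subsetI)
      fix T assume "T \<in> (\<lambda>(U, g). g ` U) ` S"
      then obtain U g where T: "T = g ` U" "g \<in> PiE U F" "U \<subseteq> Y" "card U = k"
        by (auto simp: S_def)
      have "T \<subseteq> X" using T by (auto simp: F_def PiE_iff)
      moreover have "card T = k" using T fU(2) by (metis card_image)
      moreover have "inj_on f T"
        using T by (auto simp: inj_on_def F_def PiE_iff)
      ultimately show "T \<in> {T. T \<subseteq> X \<and> card T = k \<and> inj_on f T}" by simp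
    next
      fix T assume "T \<in> {T. T \<subseteq> X \<and> card T = k \<and> inj_on f T}"
      then have T: "T \<subseteq> X" "card T = k" "inj_on f T" by auto
      \<comment> \<open>Sections are counted as elements of \<open>PiE\<close>, which are undefined
        outside their domain; hence the restriction.\<close>
      define g where "g = restrict (inv_into T f) (f ` T)"
      have "g \<in> PiE (f ` T) F"
        using T by (auto simp: g_def F_def)
      moreover have "g ` f ` T = T"
        using T by (force simp: g_def)
      moreover have "card (f ` T) = k" "f ` T \<subseteq> Y" using T Y by (auto simp: card_image)
      ultimately have "(f ` T, g) \<in> S" "T = (\<lambda>(U, g). g ` U) (f ` T, g)" by (simp_all add: S_def)
      then show "T \<in> (\<lambda>(U, g). g ` U) ` S" by (rule rev_image_eqI)
    qed
  qed
  then have "card {T. T \<subseteq> X \<and> card T = k \<and> inj_on f T} = card S"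
    by (simp add: bij_betw_same_card)
  also have "\<dots> = (\<Sum>U\<in>{U. U \<subseteq> Y \<and> card U = k}. card (PiE U F))"
    unfolding S_def
    using Y X by (intro card_SigmaI) (auto intro!: finite_PiE simp: F_def finite_subset)
  also have "\<dots> = (\<Sum>U\<in>{U. U \<subseteq> Y \<and> card U = k}. m ^ k)"
  proof (rule sum.cong[OF refl])
    fix U assume U: "U \<in> {U. U \<subseteq> Y \<and> card U = k}"
    then have "card (PiE U F) = (\<Prod>y\<in>U. card (F y))"
      using Y by (intro card_PiE) (auto simp: finite_subset)
    also have "\<dots> = (\<Prod>y\<in>U. m)"
      using U m by (intro prod.cong) (auto simp: F_def)
    finally show "card (PiE U F) = m ^ k" using U by simp
  qed
  also have "\<dots> = (card Y choose k) * m ^ k"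
    using n_subsets[OF Y(1), of k] by simp
  finally show ?thesis .
qed

text \<open>Lifts from modulus p to modulus p^i: an affine point y has the lifts y + p r and the
  point at infinity the lifts p s, with r and s below p^(i-1).\<close>

lemma card_reps_residue_class:
  assumes p: "prime p" and i: "1 \<le> i" and y: "y \<in> {0..int p}"
  shows "card {w \<in> reps (int p) i. residue_class (int p) w = y} = p ^ (i - 1)"
proof -
  have p1: "int p > 1" using p prime_gt_1_nat by auto
  have n1: "\<not> int p dvd 1" using p1 by auto
  have ne: "x mod int p \<noteq> int p" for x using p1 pos_mod_bound[of "int p" x] by linarith
  have pi: "int p ^ i = int p * int p ^ (i - 1)" using i by (metis power_eq_if not_one_le_zero)
  obtain h where h: "inj h" and
    eq: "{w \<in> reps (int p) i. residue_class (int p) w = y} = h ` {0..<int p ^ (i - 1)}"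
  proof (cases "y = int p")
    case True
    have "{w \<in> reps (int p) i. residue_class (int p) w = y} = (\<lambda>s. (int p * s, 1)) ` {0..<int p ^ (i - 1)}"
      using n1 ne True by (auto simp: reps_def residue_class_def)
    then show thesis using that[of "\<lambda>s. (int p * s, 1)"] p1 by (auto simp: inj_def)
  next
    case False
    then have y': "0 \<le> y" "y < int p" using y by auto
    have "{w \<in> reps (int p) i. residue_class (int p) w = y} =
        (\<lambda>r. (1::int, y + int p * r)) ` {0..<int p ^ (i - 1)}"
    proof (intro subset_antisym subsetI)
      fix w assume "w \<in> {w \<in> reps (int p) i. residue_class (int p) w = y}"
      then obtain t where t: "w = (1, t)" "0 \<le> t" "t < int p * int p ^ (i - 1)" "t mod int p = y"
        using False n1 by (auto simp: reps_def residue_class_def pi)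
      have "t = y + int p * (t div int p)" using t(4) by (metis mod_mult_div_eq)
      moreover have "0 \<le> t div int p" using t p1 by (simp add: pos_imp_zdiv_nonneg_iff)
      moreover have "t div int p < int p ^ (i - 1)"
      proof (rule ccontr)
        assume "\<not> t div int p < int p ^ (i - 1)"
        then have "int p * int p ^ (i - 1) \<le> int p * (t div int p)"
          using p1 by (intro mult_left_mono) auto
        then show False using t(3) \<open>t = y + int p * (t div int p)\<close> y' by linarith
      qed
      ultimately show "w \<in> (\<lambda>r. (1::int, y + int p * r)) ` {0..<int p ^ (i - 1)}"
        unfolding t(1) by (metis atLeastLessThan_iff image_eqI)
    next
      fix w assume "w \<in> (\<lambda>r. (1::int, y + int p * r)) ` {0..<int p ^ (i - 1)}"
      then obtain r where "w = (1::int, y + int p * r)" "r \<in> {0..<int p ^ (i - 1)}" by blast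
      then have r: "w = (1::int, y + int p * r)" "0 \<le> r" "r < int p ^ (i - 1)" by simp_all
      have "int p * (r + 1) \<le> int p * int p ^ (i - 1)"
        using r p1 by (intro mult_left_mono) auto
      then have "y + int p * r < int p * int p ^ (i - 1)"
        using y' by (simp add: algebra_simps)
      then show "w \<in> {w \<in> reps (int p) i. residue_class (int p) w = y}"
        using r y' n1 by (auto simp: reps_def residue_class_def pi)
    qed
    then show thesis using that[of "\<lambda>r. (1::int, y + int p * r)"] p1 by (auto simp: inj_def)
  qed
  show ?thesis unfolding eq using h by (simp add: card_image inj_on_subset nat_power_eq)
qed

lemma finite_rep_triples: "finite (rep_triples p i)"
  by (rule finite_subset[of _ "Pow (reps p i)"]) (auto simp: rep_triples_def reps_def)

lemma card_rep_triples:
  assumes p: "prime p" and i: "1 \<le> i"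
  shows "card (rep_triples (int p) i) = (Suc p choose 3) * (p ^ (i - 1)) ^ 3"
proof -
  have p1: "int p > 0" using p prime_gt_0_nat by auto
  have "card {0..int p} = Suc p" by simp
  moreover have "residue_class (int p) ` reps (int p) i \<subseteq> {0..int p}"
  proof -
    have "0 \<le> x mod int p \<and> x mod int p \<le> int p" for x
      using pos_mod_bound[OF p1, of x] pos_mod_sign[OF p1, of x] by linarith
    then show ?thesis by (auto simp: residue_class_def)
  qed
  moreover have "finite (reps (int p) i)" by (simp add: reps_def)
  ultimately show ?thesis
    unfolding rep_triples_def
    using card_partial_transversals[of "reps (int p) i" "{0..int p}" "residue_class (int p)" "p ^ (i - 1)" 3]
      card_reps_residue_class[OF p i] by simp
qed

text \<open>For e < v the condition makes s a multiple of p^(v-e), which leaves p^e values below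
  p^v; for v at most e it is vacuous and leaves p^v.\<close>

lemma card_dvd_mult_power:
  assumes p: "prime p"
  shows "card {s. 0 \<le> s \<and> s < int p ^ v \<and> int p ^ v dvd int p ^ e * s} = p ^ min e v"
proof -
  have p1: "int p > 0" using p prime_gt_0_nat by auto
  show ?thesis
  proof (cases "v \<le> e")
    case True
    then have "{s. 0 \<le> s \<and> s < int p ^ v \<and> int p ^ v dvd int p ^ e * s} = {0..<int p ^ v}"
      by (auto intro: dvd_mult2 le_imp_power_dvd)
    then show ?thesis using True by (simp add: nat_power_eq min_def)
  next
    case False
    define c where "c = int p ^ (v - e)"
    have c: "c > 0" using p1 by (simp add: c_def)
    have pv: "int p ^ v = int p ^ e * c" using False by (simp add: c_def flip: power_add)
    have "{s. 0 \<le> s \<and> s < int p ^ v \<and> int p ^ v dvd int p ^ e * s} = (\<lambda>r. c * r) ` {0..<int p ^ e}"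
    proof -
      have "0 \<le> c * r \<longleftrightarrow> 0 \<le> r" "c * r < int p ^ v \<longleftrightarrow> r < int p ^ e" for r
        using c unfolding pv by (simp_all add: zero_le_mult_iff mult.commute[of _ c])
      moreover have "int p ^ v dvd int p ^ e * s \<longleftrightarrow> c dvd s" for s
        using p1 unfolding pv by simp
      ultimately show ?thesis by (auto simp: image_iff dvd_def)
    qed
    moreover have "inj_on (\<lambda>r. c * r) {0..<int p ^ e}"
      using c by (simp add: inj_on_def)
    ultimately show ?thesis using False by (simp add: card_image nat_power_eq min_def)
  qed
qed

lemma finite_hnf_params: "finite (hnf_params p a b)"
proof (rule finite_subset)
  show "hnf_params p a b \<subseteq> (SIGMA u:{..a}. SIGMA v:{..b}. {0..<p ^ v})"
    by (auto simp: hnf_params_def)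
qed simp

lemma card_hnf_params:
  assumes p: "prime p"
  shows "card (hnf_params (int p) a b) = (\<Sum>u\<le>a. \<Sum>v\<le>b. p ^ min u v)"
proof -
  define S where "S = (\<lambda>u v. {s. 0 \<le> s \<and> s < int p ^ v \<and> int p ^ v dvd int p ^ (a - u) * s})"
  have fin: "finite (S u v)" for u v
    by (rule finite_subset[of _ "{0..<int p ^ v}"]) (auto simp: S_def)
  have "hnf_params (int p) a b = (SIGMA u:{..a}. SIGMA v:{..b}. S u v)"
    by (auto simp: hnf_params_def S_def)
  then have "card (hnf_params (int p) a b) = (\<Sum>u\<le>a. \<Sum>v\<le>b. card (S u v))"
    using fin by (simp add: card_SigmaI)
  also have "\<dots> = (\<Sum>u\<le>a. \<Sum>v\<le>b. p ^ min (a - u) v)"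
    by (simp add: S_def card_dvd_mult_power[OF p])
  \<comment> \<open>Summation over u in reverse order, replacing a - u by u.\<close>
  also have "\<dots> = (\<Sum>u\<le>a. \<Sum>v\<le>b. p ^ min u v)"
    using sum.atLeastAtMost_rev[of "\<lambda>u. \<Sum>v\<le>b. p ^ min u v" 0 a] by (simp add: atLeast0AtMost)
  finally show ?thesis .
qed

text \<open>The terms with v < k form a geometric series and the remaining n - k + 1 terms are
  constant. The factor q - 1 avoids a division.\<close>

lemma sum_power_min:
  fixes q :: real
  assumes "k \<le> n"
  shows "(q - 1) * (\<Sum>v\<le>n. q ^ min k v) = q ^ k - 1 + (real n - real k + 1) * q ^ k * (q - 1)"
  using assms
proof (induction n rule: dec_induct)
  case base
  have "(\<Sum>v\<le>k. q ^ min k v) = (\<Sum>v<k. q ^ v) + q ^ k"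
    by (simp add: min_def flip: lessThan_Suc_atMost)
  moreover have "(q - 1) * (\<Sum>v<k. q ^ v) = q ^ k - 1" by (simp add: power_diff_1_eq)
  ultimately show ?case by (simp add: algebra_simps)
next
  case (step n)
  then show ?case by (simp add: min_def algebra_simps)
qed

text \<open>This explains \<open>f_p\<close>: up to the factor (p-1)^2 it is the number of possible
  joins. Raising m by one adds a row of the double sum, whose closed form is
  \<open>sum_power_min\<close>.\<close>

lemma f_p_eq_sum:
  assumes "m \<le> n"
  shows "f_p p m n = (real p - 1) ^ 2 * (\<Sum>u\<le>m. \<Sum>v\<le>n. real p ^ min u v)"
  using assms
proof (induction m)
  case 0
  then show ?case by (simp add: f_p_def power2_eq_square algebra_simps)
next
  case (Suc m)
  define q where "q = real p"
  have "(q - 1) ^ 2 * (\<Sum>u\<le>Suc m. \<Sum>v\<le>n. q ^ min u v) =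
      f_p p m n + (q - 1) * ((q - 1) * (\<Sum>v\<le>n. q ^ min (Suc m) v))"
    using Suc by (simp add: q_def power2_eq_square algebra_simps)
  also have "\<dots> = f_p p (Suc m) n"
    unfolding sum_power_min[OF Suc.prems] by (simp add: f_p_def q_def algebra_simps power2_eq_square)
  finally show ?case by (simp add: q_def)
qed

lemma six_times_choose_3: "6 * real (Suc n choose 3) = (real n + 1) * real n * (real n - 1)"
proof (induction n)
  case (Suc n)
  have "Suc (Suc n) choose 3 = (Suc n choose 2) + (Suc n choose 3)"
    using binomial_Suc_Suc[of "Suc n" 2] by (simp add: eval_nat_numeral del: binomial_Suc_Suc)
  moreover have "2 * real (Suc n choose 2) = (real n + 1) * real n"
  proof -
    have "2 * (Suc n choose 2) = Suc n * n" unfolding choose_two by simp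
    then have "real (2 * (Suc n choose 2)) = real (Suc n * n)" by (rule arg_cong)
    then show ?thesis by (simp add: algebra_simps)
  qed
  ultimately have "6 * real (Suc (Suc n) choose 3) = 3 * ((real n + 1) * real n) + (real n + 1) * real n * (real n - 1)"
    using Suc by simp
  then show ?case by (simp add: algebra_simps)
qed simp

theorem theorem3p2:
  fixes p \<alpha>1 \<alpha>2 :: nat
  assumes "prime p" and "1 \<le> \<alpha>1" and "\<alpha>1 \<le> \<alpha>2"
  shows "real (dm (integer_mod_group (p ^ \<alpha>1) \<times>\<times> integer_mod_group (p ^ \<alpha>2))) =
    (real p + 1) / (6 * (real p - 1)) *
      (\<Sum>i = 1..\<alpha>1. real p ^ (3 * i - 2) * f_p p (\<alpha>1 - i) (\<alpha>2 - i))"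
proof -
  note p = \<open>prime p\<close>
  have ip: "prime (int p)" using p by simp
  have p1: "real p > 1" using p prime_gt_1_nat by auto
  interpret mod_pair "p ^ \<alpha>1" "p ^ \<alpha>2"
    using p prime_gt_0_nat by unfold_locales auto
  have "dm (integer_mod_group (p ^ \<alpha>1) \<times>\<times> integer_mod_group (p ^ \<alpha>2)) =
      card (lattice_diamonds (int p) \<alpha>1 \<alpha>2)"
    unfolding card_diamonds lattice_diamonds_def by simp
  also have "\<dots> = card (SIGMA i:{1..\<alpha>1}.
      hnf_params (int p) (\<alpha>1 - i) (\<alpha>2 - i) \<times> rep_triples (int p) i)"
    by (rule bij_betw_same_card[OF bij_betw_lattice_diamonds[OF ip assms(3)], symmetric])
  also have "\<dots> = (\<Sum>i = 1..\<alpha>1.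
      card (hnf_params (int p) (\<alpha>1 - i) (\<alpha>2 - i)) * card (rep_triples (int p) i))"
    by (simp add: card_SigmaI card_cartesian_product finite_hnf_params finite_rep_triples)
  finally have "real (dm (integer_mod_group (p ^ \<alpha>1) \<times>\<times> integer_mod_group (p ^ \<alpha>2))) =
      (\<Sum>i = 1..\<alpha>1.
        real (card (hnf_params (int p) (\<alpha>1 - i) (\<alpha>2 - i))) * real (card (rep_triples (int p) i)))"
    by simp
  also have "\<dots> = (\<Sum>i = 1..\<alpha>1. (real p + 1) / (6 * (real p - 1)) *
      (real p ^ (3 * i - 2) * f_p p (\<alpha>1 - i) (\<alpha>2 - i)))"
  proof (rule sum.cong[OF refl])
    fix i assume i: "i \<in> {1..\<alpha>1}"
    define N where "N = (\<Sum>u\<le>\<alpha>1 - i. \<Sum>v\<le>\<alpha>2 - i. real p ^ min u v)"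
    have lattices: "real (card (hnf_params (int p) (\<alpha>1 - i) (\<alpha>2 - i))) = N"
      by (simp add: card_hnf_params[OF p] N_def)
    have f: "f_p p (\<alpha>1 - i) (\<alpha>2 - i) = (real p - 1) ^ 2 * N"
      using f_p_eq_sum[of "\<alpha>1 - i" "\<alpha>2 - i" p] assms(3) i by (simp add: N_def)
    \<comment> \<open>3i - 2 = 1 + 3(i - 1) needs i at least 1, because subtraction of naturals is
      truncated. The single factor p comes from the binomial coefficient.\<close>
    have pow: "real p ^ (3 * i - 2) = real p * (real p ^ (i - 1)) ^ 3"
    proof -
      obtain j where "i = Suc j" using i by (cases i) auto
      then show ?thesis by (simp add: mult.commute flip: power_mult)
    qed
    have "real (card (rep_triples (int p) i)) = real (Suc p choose 3) * (real p ^ (i - 1)) ^ 3"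
      using card_rep_triples[OF p] i by simp
    also have "real (Suc p choose 3) = (real p + 1) * real p * (real p - 1) / 6"
      using six_times_choose_3[of p] by simp
    finally have triples: "real (card (rep_triples (int p) i)) =
        (real p + 1) * real p * (real p - 1) / 6 * (real p ^ (i - 1)) ^ 3" .
    show "real (card (hnf_params (int p) (\<alpha>1 - i) (\<alpha>2 - i))) * real (card (rep_triples (int p) i)) =
        (real p + 1) / (6 * (real p - 1)) * (real p ^ (3 * i - 2) * f_p p (\<alpha>1 - i) (\<alpha>2 - i))"
    proof -
      define c d where "c = real p - 1" and "d = (real p ^ (i - 1)) ^ 3"
      have "c \<noteq> 0" using p1 by (simp add: c_def)
      then show ?thesis
        unfolding lattices triples f pow c_def[symmetric] d_def[symmetric]
        by (simp add: power2_eq_square)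
    qed
  qed
  finally show ?thesis by (simp only: sum_distrib_left)
qed

end
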